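(* Let $n, t \in \mathbf{N}$ and $d \geq 1$, let $q$ be a power of an odd prime, and let $A \subseteq \mathbf{F}_q^d$ with $|A| \geq 12 n^2 q^{\frac{d-1}{2} + t}$. Then $A$ contains an isometric copy of every distance graph with $n$ vertices and maximum vertex degree $t$.
   Context: $\mathbf{F}_q$ denotes the finite field with $q$ elements, of odd characteristic. For $v,w \in \mathbf{F}_q^d$, $v\cdot w = \sum_{j=1}^d v_j w_j$ and $|v|^2 := v\cdot v$; the "distance" between $v$ and $w$ is $|v-w|^2 \in \mathbf{F}_q$. A distance graph is a finite simple graph $\mathcal{G}=(V,E)$ together with an assignment of a nonzero length $\lambda_e \in \mathbf{F}_q^* = \mathbf{F}_q\setminus\{0\}$ to each edge $e\in E$. A set $X \subseteq \mathbf{F}_q^d$ is an isometric copy of $\mathcal{G}$ if there is a bijection $\varphi: V \to X$ such that $|\varphi(v)-\varphi(w)|^2 = \lambda_e$ whenever $v,w\in V$ are joined by an edge $e$. "$A$ contains an isometric copy" means some $X\subseteq A$ is an isometric copy. *)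

theory Defs
  imports "HOL-Analysis.Analysis"
begin

text \<open>Vectors in F_q^d are modelled as 'a ^ 'd, with 'a a finite field and 'd a finite index type
  of cardinality d.\<close>

definition fdot :: "'a::field ^ 'd \<Rightarrow> 'a ^ 'd \<Rightarrow> 'a" where
  "fdot v w = (\<Sum>j\<in>UNIV. v $ j * w $ j)"

definition fnorm2 :: "'a::field ^ 'd \<Rightarrow> 'a" where
  "fnorm2 v = fdot v v"

definition distance_graph :: "'v set \<Rightarrow> 'v set set \<Rightarrow> ('v set \<Rightarrow> 'a::field) \<Rightarrow> bool" where
  "distance_graph V E lam \<longleftrightarrow> finite V
     \<and> E \<subseteq> {{u, w} | u w. u \<in> V \<and> w \<in> V \<and> u \<noteq> w}
     \<and> (\<forall>e\<in>E. lam e \<noteq> 0)"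

definition vdegree :: "'v set \<Rightarrow> 'v set set \<Rightarrow> 'v \<Rightarrow> nat" where
  "vdegree V E v = card {w \<in> V. {v, w} \<in> E}"

definition isometric_copy ::
  "('a::field ^ 'd) set \<Rightarrow> 'v set \<Rightarrow> 'v set set \<Rightarrow> ('v set \<Rightarrow> 'a) \<Rightarrow> bool" where
  "isometric_copy X V E lam \<longleftrightarrow>
     (\<exists>\<phi>. bij_betw \<phi> V X \<and>
        (\<forall>u\<in>V. \<forall>w\<in>V. {u, w} \<in> E \<longrightarrow> fnorm2 (\<phi> u - \<phi> w) = lam {u, w}))"

definition contains_isometric_copy ::
  "('a::field ^ 'd) set \<Rightarrow> 'v set \<Rightarrow> 'v set set \<Rightarrow> ('v set \<Rightarrow> 'a) \<Rightarrow> bool" where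
  "contains_isometric_copy A V E lam \<longleftrightarrow> (\<exists>X\<subseteq>A. isometric_copy X V E lam)"

end

(*
  The graph joining points of F_q^d at distance r, r nonzero, is pseudorandom: between any B and C
  the number of edges differs from |B||C|/q by at most 2 q^((d-1)/2) sqrt(|B||C|).  Expanding the
  indicator of |x - y|^2 = r into additive characters reduces this to a bound for Kloosterman sums
  (d even) and Salie sums (d odd); the latter are evaluated explicitly.

  For Kloosterman sums, write K_n for the sum over the field with p^n elements.  Counting pairs (x, y)
  by sum and product gives K_n^2 + K_2n = 2 p^n, so |K_n| > 2 p^(n/2) would make K_(2^j n) / p^(2^j n/2)
  grow without bound.  Stepanov's method excludes this: with Q = p^(2m) and R = p^m, the solutions of
  Tr(a x + b/x) = c satisfy x^Q = x and u^R = c - u, where u is the sum of the first m conjugates of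
  a x + b/x.  Polynomials H = sum s_ij X^(jR) u^i, not zero because their terms have distinct degrees,
  can be chosen by linear algebra such that H^R vanishes on all solutions after this substitution, so
  that there are at most deg H = Q/p + O(R) of them.

  The vertices of the distance graph are then embedded one at a time.  Every vertex v not yet placed
  keeps its set of candidates, of size at least |A| ((1 - 1/(2|V|)) / q)^k if k neighbours of v are
  placed; by pseudorandomness fewer points than the candidates of the next vertex are excluded.
*)

theory Submission
  imports Defs "HOL-Number_Theory.Residues" "HOL-Algebra.Algebraic_Closure_Type"
begin

hide_const (open) Polynomials.degree Polynomials.lead_coeff UnivPoly.coeff UnivPoly.monom Module.smult Divisibility.prime Coset.order

section \<open>Linear systems and polynomials of distinct degrees\<close>

lemma homogeneous_system_nontrivial_solution:
  fixes M :: "'e \<Rightarrow> 'i \<Rightarrow> 'k::field"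
  assumes "finite E" "finite I" "card E < card I"
  shows "\<exists>c. (\<exists>i\<in>I. c i \<noteq> 0) \<and> (\<forall>e\<in>E. (\<Sum>i\<in>I. M e i * c i) = 0)"
  using assms
proof (induction E arbitrary: I M rule: finite_induct)
  case empty
  then have "I \<noteq> {}" by auto
  then show ?case by (intro exI[of _ "\<lambda>_. 1"]) auto
next
  case (insert e E)
  show ?case
  proof (cases "\<forall>i\<in>I. M e i = 0")
    case True
    have "card E < card I" using insert by auto
    from insert.IH[OF insert.prems(1) this, of M] True show ?thesis
      by auto
  next
    case False
    then obtain k where k: "k \<in> I" "M e k \<noteq> 0" by auto
    \<comment> \<open>Gaussian elimination: equation \<open>e\<close> is solved for the unknown
      \<open>k\<close>, and \<open>M'\<close> is the system left for the other unknowns.\<close>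
    define M' where "M' e' i = M e' i - M e' k * M e i / M e k" for e' i
    have "card E < card (I - {k})" using insert k by simp
    from insert.IH[OF _ this, of M'] insert.prems(1) obtain c where
      c: "\<exists>i\<in>I-{k}. c i \<noteq> 0" "\<forall>e'\<in>E. (\<Sum>i\<in>I-{k}. M' e' i * c i) = 0" by auto
    define s where "s = (\<Sum>i\<in>I-{k}. M e i * c i)"
    define d where "d = c(k := - s / M e k)"
    have split: "(\<Sum>i\<in>I. M e' i * d i) = - M e' k * s / M e k + (\<Sum>i\<in>I-{k}. M e' i * c i)" for e'
    proof -
      have "(\<Sum>i\<in>I. M e' i * d i) = M e' k * d k + (\<Sum>i\<in>I-{k}. M e' i * d i)"
        using k insert.prems(1) by (simp add: sum.remove)
      also have "(\<Sum>i\<in>I-{k}. M e' i * d i) = (\<Sum>i\<in>I-{k}. M e' i * c i)"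
        by (intro sum.cong) (auto simp: d_def)
      finally show ?thesis by (simp add: d_def)
    qed
    have "(\<Sum>i\<in>I. M e' i * d i) = 0" if "e' \<in> E" for e'
    proof -
      have "0 = (\<Sum>i\<in>I-{k}. M' e' i * c i)" using c that by simp
      also have "\<dots> = (\<Sum>i\<in>I-{k}. M e' i * c i) - (\<Sum>i\<in>I-{k}. M e' k / M e k * (M e i * c i))"
        by (simp add: M'_def algebra_simps sum_subtractf)
      also have "(\<Sum>i\<in>I-{k}. M e' k / M e k * (M e i * c i)) = M e' k / M e k * s"
        by (simp add: s_def sum_distrib_left)
      finally show ?thesis by (simp add: split)
    qed
    moreover have "(\<Sum>i\<in>I. M e i * d i) = 0"
      using k by (simp add: split s_def)
    moreover have "\<exists>i\<in>I. d i \<noteq> 0" using c(1) by (auto simp: d_def)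
    ultimately show ?thesis by auto
  qed
qed

text \<open>Among the terms with nonzero coefficient, the one of largest degree has nothing to
  cancel against. This serves for the trace polynomial and for the auxiliary polynomial of
  Stepanov's method.\<close>

lemma sum_poly_distinct_degrees_nonzero:
  fixes P :: "'i \<Rightarrow> 'k::idom poly"
  assumes "finite I" "inj_on (\<lambda>i. degree (P i)) I" "\<And>i. i \<in> I \<Longrightarrow> P i \<noteq> 0"
    and "\<exists>i\<in>I. c i \<noteq> 0"
  shows "(\<Sum>i\<in>I. smult (c i) (P i)) \<noteq> 0"
proof -
  define J where "J = {i\<in>I. c i \<noteq> 0}"
  have J: "finite J" "J \<noteq> {}" "J \<subseteq> I" using assms by (auto simp: J_def)
  obtain k where k: "k \<in> J" "\<And>i. i \<in> J \<Longrightarrow> degree (P i) \<le> degree (P k)"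
  proof -
    have "Max ((\<lambda>i. degree (P i)) ` J) \<in> (\<lambda>i. degree (P i)) ` J"
      using J by (intro Max_in) auto
    then obtain k where "k \<in> J" "degree (P k) = Max ((\<lambda>i. degree (P i)) ` J)" by auto
    with J(1) that show thesis by simp
  qed
  have less: "coeff (P i) (degree (P k)) = 0" if "i \<in> J" "i \<noteq> k" for i
  proof -
    have "degree (P i) \<noteq> degree (P k)"
      using assms(2) J(3) that k(1) by (auto dest: inj_onD)
    then show ?thesis using k(2)[OF that(1)] by (intro coeff_eq_0) auto
  qed
  have "coeff (\<Sum>i\<in>I. smult (c i) (P i)) (degree (P k)) = (\<Sum>i\<in>I. c i * coeff (P i) (degree (P k)))"
    by (simp add: coeff_sum)
  also have "\<dots> = (\<Sum>i\<in>{k}. c i * coeff (P i) (degree (P k)))"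
    using assms(1) k(1) J(3) less by (intro sum.mono_neutral_right) (auto simp: J_def)
  also have "\<dots> \<noteq> 0" using k(1) J(3) assms(3) by (auto simp: J_def)
  finally show ?thesis by force
qed

subsection \<open>Finite subfields of an algebraically closed field\<close>

text \<open>All finite fields of characteristic \<open>p\<close> lie in one algebraically closed
  field as fixed points of powers of Frobenius, so the sums for \<open>n\<close> and
  \<open>2 * n\<close> can be compared without embeddings. Roots of coefficients exist here
  too.\<close>

locale odd_char_closed_field =
  fixes p :: nat and field_type :: "'k::alg_closed_field itself"
  assumes p_eq: "p = CHAR('k)" and prime_p: "prime p" and odd_p: "odd p"
begin

text \<open>For \<open>n > 0\<close> this is the subfield with \<open>p\<^sup>n\<close> elements, but \<open>F 0\<close> is the whole field.\<close>

definition F :: "nat \<Rightarrow> 'k set" where "F n = {x. x ^ (p ^ n) = x}"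

text \<open>On \<open>F n\<close> this is the trace to the prime field. On a larger field it is a
  partial trace, the sum of the first \<open>n\<close> conjugates.\<close>

definition Tr :: "nat \<Rightarrow> 'k \<Rightarrow> 'k" where "Tr n x = (\<Sum>i<n. x ^ (p ^ i))"

lemma p_gt_2: "p > 2"
  using prime_p odd_p by (metis even_numeral le_neq_implies_less prime_ge_2_nat)

lemma p_gt_1: "1 < p" and p_pos [simp]: "0 < p"
  using p_gt_2 by auto

lemma frob_add: "((x::'k) + y) ^ (p ^ n) = x ^ (p ^ n) + y ^ (p ^ n)"
  by (rule freshmans_dream'[of _ n]) (use prime_p p_eq in auto)

lemma frob_sum: "(\<Sum>i\<in>I. f i :: 'k) ^ (p ^ n) = (\<Sum>i\<in>I. f i ^ (p ^ n))"
  by (rule freshmans_dream_sum'[of _ n]) (use prime_p p_eq in auto)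

lemma frob_minus: "(- x :: 'k) ^ (p ^ n) = - (x ^ (p ^ n))"
  using odd_p by simp

lemma frob_diff: "((x::'k) - y) ^ (p ^ n) = x ^ (p ^ n) - y ^ (p ^ n)"
  using frob_add[of x "-y" n] frob_minus by simp

lemma two_neq_0: "(2::'k) \<noteq> 0"
proof
  assume "(2::'k) = 0"
  then have "of_nat 2 = (0::'k)" by simp
  then have "p dvd 2" using p_eq of_nat_eq_0_iff_char_dvd[of 2, where ?'a='k] by simp
  then show False using p_gt_2 by (auto dest: dvd_imp_le)
qed

lemma of_nat_frob: "(of_nat t :: 'k) ^ (p ^ n) = of_nat t"
  by (induction t) (simp_all add: frob_add)

lemma F_0 [simp]: "0 \<in> F n"
  using p_gt_2 by (auto simp: F_def)

lemma F_closed: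
  "x \<in> F n \<Longrightarrow> y \<in> F n \<Longrightarrow> x + y \<in> F n" "x \<in> F n \<Longrightarrow> y \<in> F n \<Longrightarrow> x - y \<in> F n"
  "x \<in> F n \<Longrightarrow> y \<in> F n \<Longrightarrow> x * y \<in> F n" "x \<in> F n \<Longrightarrow> y \<in> F n \<Longrightarrow> x / y \<in> F n"
  "x \<in> F n \<Longrightarrow> - x \<in> F n" "of_nat t \<in> F n"
  by (simp_all add: F_def frob_add frob_diff power_mult_distrib power_divide frob_minus of_nat_frob)

lemma frob_mult_exp: "x \<in> F n \<Longrightarrow> x ^ (p ^ (n * j)) = x"
proof (induction j)
  case (Suc j)
  have "x ^ (p ^ (n * Suc j)) = (x ^ (p ^ n)) ^ (p ^ (n * j))"
    by (simp add: power_add power_mult)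
  with Suc show ?case by (simp add: F_def)
qed simp

lemma F_mono_dvd: "n dvd m \<Longrightarrow> F n \<subseteq> F m"
  using frob_mult_exp by (auto simp: F_def)

text \<open>The polynomial X^q - X with q = p^n has derivative -1, hence no double root, and over an
  algebraically closed field it has q roots counted with multiplicity.\<close>

lemma card_F:
  assumes "n > 0"
  shows "finite (F n)" "card (F n) = p ^ n"
proof -
  define q where "q = p ^ n"
  have q: "q > 1" unfolding q_def using p_gt_1 assms by (rule one_less_power)
  define P :: "'k poly" where "P = monom 1 q - monom 1 1"
  have deg: "degree P = q"
    unfolding P_def using q by (simp add: degree_monom_eq diff_conv_add_uminus degree_add_eq_left del: add_uminus_conv_diff)
  have P0: "P \<noteq> 0" using deg q by auto
  have roots: "{x. poly P x = 0} = F n"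
    by (auto simp: P_def poly_monom F_def q_def)
  have q0: "(of_nat q :: 'k) = 0"
    using assms p_eq by (simp add: q_def)
  have pderiv: "pderiv P = -1"
    by (simp add: P_def pderiv_diff pderiv_monom q0 monom_0 one_pCons)
  have ord: "order x P \<le> 1" for x
  proof (rule ccontr)
    assume "\<not> order x P \<le> 1"
    then have "[:-x, 1:] ^ 2 dvd P" by (auto simp: order_divides)
    then obtain Q where "P = [:-x, 1:] * ([:-x, 1:] * Q)"
      unfolding power2_eq_square mult.assoc dvd_def by blast
    then have "poly (pderiv P) x = 0" by (simp add: pderiv_mult del: mult_pCons_left)
    then show False by (simp add: pderiv)
  qed
  obtain A where A: "size A = degree P" "P = smult (lead_coeff P) (\<Prod>x\<in>#A. [:-x, 1:])"
    using alg_closed_imp_factorization[OF P0] by blast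
  have "proots P = A"
  proof -
    have nz: "(\<Prod>x\<in>#B. [:-x, 1:]) \<noteq> 0" for B :: "'k multiset"
      by (induction B) (simp_all del: mult_pCons_left)
    have proots_A: "proots (\<Prod>x\<in>#A. [:-x, 1:]) = A"
    proof (induction A)
      case (add x B)
      have "[:-x, 1:] \<noteq> 0" by simp
      from proots_mult[OF this nz[of B]] show ?case by (simp add: add del: mult_pCons_left)
    qed simp
    have "proots P = proots (\<Prod>x\<in>#A. [:-x, 1:])"
      using A(2) P0 by (metis leading_coeff_0_iff proots_smult)
    also have "\<dots> = A"
      by (rule proots_A)
    finally show ?thesis .
  qed
  then have "size (proots P) = q" using A deg by simp
  moreover have "size (proots P) = (\<Sum>x\<in>F n. order x P)"
    unfolding size_multiset_overloaded_eq using P0 roots by simp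
  moreover have fin: "finite (F n)" using poly_roots_finite[OF P0] roots by simp
  ultimately have "q \<le> card (F n)"
    using sum_mono[of "F n" "\<lambda>x. order x P" "\<lambda>_. 1"] ord by simp
  moreover have "card (F n) \<le> q"
    using card_poly_roots_bound[OF P0] roots deg by simp
  ultimately show "card (F n) = p ^ n" by (simp add: q_def)
  show "finite (F n)" by (rule fin)
qed

lemma Tr_add: "Tr n (x + y) = Tr n x + Tr n y"
  by (simp add: Tr_def frob_add sum.distrib)

lemma F_1_eq: "F 1 = of_nat ` {..<p}"
proof -
  have "inj_on (of_nat :: nat \<Rightarrow> 'k) {..<p}"
    by (rule inj_onI) (auto simp: of_nat_eq_iff_cong_CHAR cong_def simp flip: p_eq)
  then have "card (of_nat ` {..<p} :: 'k set) = card (F 1)"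
    using card_F[of 1] by (simp add: card_image)
  moreover have "of_nat ` {..<p} \<subseteq> F 1" using F_closed(6) by auto
  ultimately show ?thesis
    using card_F[of 1] card_subset_eq[of "F 1" "of_nat ` {..<p}"] by simp
qed

text \<open>Raising to the power \<open>p\<close> permutes the conjugates cyclically. For
  \<open>n = 0\<close> the field is the whole closure, but the trace is an empty sum.\<close>

lemma Tr_in_F_1:
  assumes "x \<in> F n"
  shows "Tr n x \<in> F 1"
proof (cases n)
  case 0 then show ?thesis using assms by (simp add: Tr_def)
next
  case (Suc m)
  have "Tr n x ^ p = (\<Sum>i<n. x ^ (p ^ Suc i))"
    unfolding Tr_def using frob_sum[of "\<lambda>i. x ^ (p ^ i)" "{..<n}" 1]
    by (simp flip: power_mult add: mult.commute)
  also have "\<dots> = (\<Sum>i<m. x ^ (p ^ Suc i)) + x ^ (p ^ n)" by (simp add: Suc)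
  also have "\<dots> = (\<Sum>i<m. x ^ (p ^ Suc i)) + x ^ (p ^ 0)" using assms by (simp add: F_def)
  also have "\<dots> = Tr n x" unfolding Tr_def Suc sum.lessThan_Suc_shift by simp
  finally show ?thesis by (simp add: F_def)
qed

text \<open>The trace is a nonzero polynomial of degree at most p^(n-1), too small to vanish at p^n
  points.\<close>

lemma Tr_nontrivial:
  assumes "n > 0"
  shows "\<exists>x\<in>F n. Tr n x \<noteq> 0"
proof (rule ccontr)
  assume *: "\<not> ?thesis"
  define P :: "'k poly" where "P = (\<Sum>i<n. smult 1 (monom 1 (p ^ i)))"
  have P0: "P \<noteq> 0"
    unfolding P_def
  proof (rule sum_poly_distinct_degrees_nonzero)
    show "inj_on (\<lambda>i. degree (monom (1::'k) (p ^ i))) {..<n}"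
      using p_gt_2 by (auto simp: degree_monom_eq inj_on_def)
  qed (use assms in auto)
  have "degree P \<le> p ^ (n - 1)"
    unfolding P_def using p_gt_2
    by (intro degree_sum_le) (auto simp: degree_monom_eq intro!: power_increasing)
  moreover have "F n \<subseteq> {x. poly P x = 0}"
    using * by (auto simp: P_def poly_sum poly_monom Tr_def)
  then have "card (F n) \<le> card {x. poly P x = 0}"
    by (intro card_mono poly_roots_finite P0)
  ultimately have "p ^ n \<le> p ^ (n - 1)"
    using card_poly_roots_bound[OF P0] card_F[OF assms] by linarith
  then show False using p_gt_2 assms by (simp add: power_increasing_iff)
qed

subsection \<open>Stepanov's method\<close>

text \<open>A fibre of the trace should hold one p-th of the field, and the error is of the order of
  the square root of the field size. The auxiliary polynomial \<open>P\<close> vanishes on the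
  fibre, so its degree bounds the count. Control from below comes later, from the total over all
  \<open>c\<close>.\<close>

lemma card_trace_fibre_le:
  assumes ab: "a \<noteq> 0" and m: "m > 0"
  shows "card {x\<in>F (2*m). x \<noteq> 0 \<and> Tr (2*m) (a * x + b / x) = c} \<le> p ^ (2*m-1) + 6 * p ^ m"
proof -
  define S R where "S = p ^ (m - 1)" and "R = p ^ m"
  have S: "S > 0" and RS: "R = p * S"
    using p_gt_2 m by (auto simp: S_def R_def simp flip: power_Suc)
  \<comment> \<open>A triple (i, j, k) stands for X^(k + jR) u^i. The range of j exceeds S by 4 so
    that the p J S = S R + 4 R unknowns outnumber the \<open>D\<close> equations below.\<close>
  define J where "J = S + 4"
  define I where "I = {..<p} \<times> {..<J} \<times> {..<S}"
  \<comment> \<open>\<open>w = X\<^sup>S u\<close> for the partial trace \<open>u\<close> of \<open>a X + b / X\<close>; \<open>G\<close> and \<open>H\<close> are cleared of their poles at 0 in the same way.\<close>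
  define w :: "'k poly" where "w = (\<Sum>i<m. monom (a ^ (p ^ i)) (S + p ^ i) + monom (b ^ (p ^ i)) (S - p ^ i))"
  have pS: "p ^ i \<le> S" if "i < m" for i
    using that p_gt_2 by (auto simp: S_def intro!: power_increasing)
  have degw_le: "degree w \<le> 2 * S"
    unfolding w_def
  proof (intro degree_sum_le degree_add_le)
    fix i assume "i \<in> {..<m}"
    then show "degree (monom (a ^ p ^ i) (S + p ^ i)) \<le> 2 * S" "degree (monom (b ^ p ^ i) (S - p ^ i)) \<le> 2 * S"
      using pS[of i] by (auto intro!: order_trans[OF degree_monom_le])
  qed auto
  \<comment> \<open>Only i = m - 1 reaches degree 2S, with coefficient a^S.\<close>
  have "coeff w (2 * S) = (\<Sum>i<m. if i = m - 1 then a ^ S else 0)"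
    unfolding w_def coeff_sum
  proof (intro sum.cong refl)
    fix i assume i: "i \<in> {..<m}"
    have "S + p ^ i = 2 * S \<longleftrightarrow> i = m - 1"
      using i p_gt_2 by (auto simp: S_def)
    moreover have "S - p ^ i \<noteq> 2 * S" using S p_gt_2 by linarith
    ultimately show "coeff (monom (a ^ p ^ i) (S + p ^ i) + monom (b ^ p ^ i) (S - p ^ i)) (2 * S) = (if i = m - 1 then a ^ S else 0)"
      by (auto simp: S_def)
  qed
  also have "\<dots> = a ^ S" using m by simp
  finally have lcw: "coeff w (2 * S) \<noteq> 0" using ab by simp
  then have degw: "degree w = 2 * S" using degw_le le_degree[of w "2*S"] by simp
  then have w0: "w \<noteq> 0" using lcw by auto
  \<comment> \<open>At a solution, the R-th power turns x^(k + jR) u^i into x^(kR + j) (c - u)^i,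
    because x^(R R) = x. \<open>H\<close> holds the terms before this step and \<open>G\<close>
    those after it; since j and k exchange their roles, the degree of \<open>G\<close> stays near S
    R.\<close>
  define G :: "nat \<times> nat \<times> nat \<Rightarrow> 'k poly" where
    "G = (\<lambda>(i,j,k). monom 1 (k * R + j) * (monom c S - w) ^ i * monom 1 ((p - 1 - i) * S))"
  define H :: "nat \<times> nat \<times> nat \<Rightarrow> 'k poly" where
    "H = (\<lambda>(i,j,k). monom 1 (k + j * R) * w ^ i * monom 1 ((p - 1 - i) * S))"
  define D where "D = S * R + J + 2 * R"
  have degG: "degree (G t) < D" if "t \<in> I" for t
  proof -
    obtain i j k where t: "t = (i,j,k)" and ijk: "i < p" "j < J" "k < S" using \<open>t \<in> I\<close> by (auto simp: I_def)
    have "degree (monom c S - w) \<le> 2 * S"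
      by (intro degree_diff_le order_trans[OF degree_monom_le] degw_le) auto
    then have "degree ((monom c S - w) ^ i) \<le> 2 * S * i"
      by (metis degree_power_le mult_le_mono1 order_trans)
    then have "degree (G t) \<le> (k * R + j) + 2 * S * i + (p - 1 - i) * S"
      unfolding t G_def prod.case
      by (intro order_trans[OF degree_mult_le] add_mono order_trans[OF degree_monom_le]) auto
    moreover have "2 * S * i + (p - 1 - i) * S = (i + (p - 1)) * S"
    proof -
      obtain e where "p = Suc (i + e)" using ijk(1) by (metis less_natE)
      then show ?thesis by (simp add: algebra_simps)
    qed
    moreover have "(i + (p - 1)) * S \<le> (2 * p) * S" using ijk by (intro mult_right_mono) auto
    moreover have "k * R \<le> S * R" using ijk by simp
    moreover have "(2 * p) * S = 2 * R" using RS by simp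
    ultimately show ?thesis using ijk unfolding D_def by linarith
  qed
  have "card {..<D} < card I"
  proof -
    have "card I = p * J * S" by (simp add: I_def card_cartesian_product)
    also have "\<dots> = S * R + 4 * R" by (simp add: RS J_def algebra_simps)
    finally have 1: "card I = S * R + 4 * R" .
    have "3 * S \<le> R" unfolding RS using p_gt_2 by (intro mult_right_mono) auto
    then show ?thesis unfolding 1 D_def J_def using S by simp
  qed
  from homogeneous_system_nontrivial_solution[OF _ _ this, of "\<lambda>e t. coeff (G t) e"]
  obtain d where d: "\<exists>t\<in>I. d t \<noteq> 0" "\<forall>e<D. (\<Sum>t\<in>I. coeff (G t) e * d t) = 0"
    by (auto simp: I_def)
  have G0: "(\<Sum>t\<in>I. smult (d t) (G t)) = 0"
  proof (rule poly_eqI)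
    fix e
    show "coeff (\<Sum>t\<in>I. smult (d t) (G t)) e = coeff 0 e"
    proof (cases "e < D")
      case True
      then show ?thesis using d(2) by (simp add: coeff_sum mult.commute)
    next
      case False
      then have "coeff (G t) e = 0" if "t \<in> I" for t
        using degG[OF that] by (intro coeff_eq_0) auto
      then show ?thesis by (simp add: coeff_sum)
    qed
  qed
  \<comment> \<open>The R-th power also acts on coefficients, so \<open>P\<close> is built from R-th
    roots of the solution \<open>d\<close>.\<close>
  have "\<exists>z. z ^ R = d t" for t
    using nth_root_exists[of R "d t"] p_gt_2 by (auto simp: R_def)
  then obtain r where r: "\<And>t. r t ^ R = d t" by metis
  define P where "P = (\<Sum>t\<in>I. smult (r t) (H t))"
  \<comment> \<open>Up to a common shift the degree has k as its digit in base S, above it i as a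
    digit in base p, and then j; distinct triples therefore give distinct degrees.\<close>
  have degH: "degree (H (i,j,k)) = k + S * (i + p * j + (p - 1))" and H0: "H (i,j,k) \<noteq> 0" if "i < p" for i j k
  proof -
    have "degree (H (i,j,k)) = (k + j * R) + i * (2 * S) + (p - 1 - i) * S"
      unfolding H_def prod.case using w0
      by (simp add: degree_mult_eq degree_monom_eq degree_power_eq degw)
    also have "\<dots> = k + S * (i + p * j + (p - 1))"
    proof -
      obtain e where "p = Suc (i + e)" using \<open>i < p\<close> by (metis less_natE)
      then show ?thesis by (simp add: RS algebra_simps)
    qed
    finally show "degree (H (i,j,k)) = k + S * (i + p * j + (p - 1))" .
    show "H (i,j,k) \<noteq> 0" unfolding H_def using w0 by simp
  qed
  have P0: "P \<noteq> 0"
    unfolding P_def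
  proof (rule sum_poly_distinct_degrees_nonzero)
    show "finite I" by (simp add: I_def)
    show "inj_on (\<lambda>t. degree (H t)) I"
    proof (rule inj_onI)
      fix t t' assume t: "t \<in> I" "t' \<in> I" and eq: "degree (H t) = degree (H t')"
      obtain i j k i' j' k' where t': "t = (i,j,k)" "t' = (i',j',k')" by (cases t, cases t') auto
      have b: "i < p" "k < S" "i' < p" "k' < S" using t t' by (auto simp: I_def)
      have eq: "k + S * (i + p * j + (p - 1)) = k' + S * (i' + p * j' + (p - 1))"
        using eq degH b by (simp add: t')
      have "k = k'" using arg_cong[OF eq, of "\<lambda>x. x mod S"] b by simp
      with eq S have eq2: "i + p * j = i' + p * j'" by simp
      have "i = i'" using arg_cong[OF eq2, of "\<lambda>x. x mod p"] b by simp
      with eq2 p_gt_2 have "j = j'" by simp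
      with \<open>i = i'\<close> \<open>k = k'\<close> show "t = t'" by (simp add: t')
    qed
    show "H t \<noteq> 0" if "t \<in> I" for t using that H0 by (auto simp: I_def)
    show "\<exists>t\<in>I. r t \<noteq> 0" 
    proof -
      obtain t where "t \<in> I" "d t \<noteq> 0" using d(1) by blast
      moreover have "(0::'k) ^ R = 0" using p_gt_2 by (simp add: R_def)
      then have "r t = 0 \<Longrightarrow> d t = 0" using r[of t] by metis
      ultimately show ?thesis by blast
    qed
  qed
  \<comment> \<open>The part j R with j < S + 4 gives the main term S R = p^(2m-1); everything else
    is of order R.\<close>
  have "degree P \<le> S * R + 6 * R"
    unfolding P_def
  proof (intro degree_sum_le order_trans[OF degree_smult_le])
    fix t assume "t \<in> I"
    then obtain i j k where t: "t = (i,j,k)" and ijk: "i < p" "j < J" "k < S" by (auto simp: I_def)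
    have "i + p * j + (p - 1) + 1 \<le> 2 * p + p * (S + 3)"
    proof -
      have "p * j \<le> p * (S + 3)" using ijk by (intro mult_left_mono) (auto simp: J_def)
      then show ?thesis using ijk(1) by linarith
    qed
    then have "S * (i + p * j + (p - 1) + 1) \<le> S * (2 * p + p * (S + 3))" by (rule mult_left_mono) simp
    also have "\<dots> = S * R + 5 * R" by (simp add: RS algebra_simps)
    finally have "S * (i + p * j + (p - 1)) + S \<le> S * R + 5 * R" by (simp only: distrib_left mult_1_right)
    then show "degree (H t) \<le> S * R + 6 * R"
      unfolding t degH[OF ijk(1)] using ijk(3) by linarith
  qed (simp add: I_def)
  moreover have "{x\<in>F (2*m). x \<noteq> 0 \<and> Tr (2*m) (a * x + b / x) = c} \<subseteq> {x. poly P x = 0}"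
  proof safe
    fix x assume x: "x \<in> F (2*m)" "x \<noteq> 0" and c: "c = Tr (2*m) (a * x + b / x)"
    define y where "y = a * x + b / x"
    define u where "u = Tr m y"
    \<comment> \<open>The R-th power carries the first m conjugates of y to the other m, so u + u^R
      is the full trace c.\<close>
    have "u ^ R = (\<Sum>i<m. y ^ (p ^ (i + m)))"
      unfolding u_def Tr_def R_def frob_sum by (simp flip: power_mult power_add)
    moreover have "Tr (2 * m) y = u + (\<Sum>i<m. y ^ (p ^ (i + m)))"
    proof -
      have "{..<2*m} = {..<m} \<union> {m..<m+m}" by auto
      then have "Tr (2 * m) y = u + (\<Sum>i=m..<m+m. y ^ (p ^ i))"
        unfolding Tr_def u_def by (simp add: sum.union_disjoint ivl_disj_int)
      also have "(\<Sum>i=m..<m+m. y ^ (p ^ i)) = (\<Sum>i<m. y ^ (p ^ (i + m)))"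
        using sum.shift_bounds_nat_ivl[of "\<lambda>i. y ^ (p ^ i)" 0 m m] by (simp add: lessThan_atLeast0)
      finally show ?thesis .
    qed
    ultimately have uR: "u ^ R = c - u" by (simp add: c y_def)
    have xQ: "x ^ (R * R) = x" using x(1) by (simp add: F_def R_def mult_2 power_add)
    have wx: "poly w x = x ^ S * u"
    proof -
      have "poly w x = (\<Sum>i<m. a ^ p ^ i * x ^ (S + p ^ i) + b ^ p ^ i * x ^ (S - p ^ i))"
        by (simp add: w_def poly_sum poly_monom)
      also have "\<dots> = (\<Sum>i<m. x ^ S * y ^ (p ^ i))"
      proof (intro sum.cong refl)
        fix i assume "i \<in> {..<m}"
        then have "x ^ (S - p ^ i) = x ^ S / x ^ (p ^ i)" using pS[of i] x(2) by (simp add: power_diff)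
        then show "a ^ p ^ i * x ^ (S + p ^ i) + b ^ p ^ i * x ^ (S - p ^ i) = x ^ S * y ^ p ^ i"
          by (simp add: y_def frob_add power_mult_distrib power_divide power_add algebra_simps)
      qed
      finally show ?thesis by (simp add: u_def Tr_def sum_distrib_left)
    qed
    have Hx: "poly (H (i,j,k)) x = x ^ ((p - 1) * S) * (x ^ (k + j * R) * u ^ i)"
      and Gx: "poly (G (i,j,k)) x = x ^ ((p - 1) * S) * (x ^ (k * R + j) * (c - u) ^ i)"
      if "i < p" for i j k
    proof -
      have "i * S + (p - 1 - i) * S = (p - 1) * S"
      proof -
        obtain e where "p = Suc (i + e)" using \<open>i < p\<close> by (metis less_natE)
        then show ?thesis by (simp add: algebra_simps)
      qed
      then have xx: "x ^ ((p - 1) * S) = (x ^ S) ^ i * x ^ ((p - 1 - i) * S)"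
        by (metis mult.commute power_add power_mult)
      show "poly (H (i,j,k)) x = x ^ ((p - 1) * S) * (x ^ (k + j * R) * u ^ i)"
        unfolding xx H_def by (simp add: poly_monom poly_power wx power_mult_distrib mult_ac)
      have "poly (monom c S - w) x = x ^ S * (c - u)"
        by (simp add: poly_monom wx algebra_simps)
      then show "poly (G (i,j,k)) x = x ^ ((p - 1) * S) * (x ^ (k * R + j) * (c - u) ^ i)"
        unfolding xx G_def by (simp add: poly_monom poly_power power_mult_distrib mult_ac)
    qed
    have "poly P x ^ R = (\<Sum>t\<in>I. r t * poly (H t) x) ^ R"
      by (simp add: P_def poly_sum)
    also have "\<dots> = (\<Sum>t\<in>I. (r t * poly (H t) x) ^ R)"
      unfolding R_def by (rule frob_sum)
    \<comment> \<open>Both families carry the factor x^((p-1)S), which for \<open>H\<close> is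
      raised to the power R. The quotient does not depend on the triple, so it comes out of the sum
      and leaves the vanishing combination of the \<open>G t\<close>.\<close>
    also have "\<dots> = (\<Sum>t\<in>I. (x ^ ((p - 1) * S)) ^ R / x ^ ((p - 1) * S) * (d t * poly (G t) x))"
    proof (intro sum.cong refl)
      fix t assume "t \<in> I"
      then obtain i j k where t: "t = (i,j,k)" and i: "i < p" by (auto simp: I_def)
      have "x ^ ((k + j * R) * R) = x ^ (k * R) * (x ^ (R * R)) ^ j"
        by (simp add: algebra_simps flip: power_add power_mult)
      then have 1: "(x ^ (k + j * R)) ^ R = x ^ (k * R + j)"
        unfolding xQ by (simp add: power_add power_mult)
      have 2: "(u ^ i) ^ R = (c - u) ^ i" unfolding uR[symmetric] by (simp flip: power_mult add: mult.commute)
      show "(r t * poly (H t) x) ^ R = (x ^ ((p - 1) * S)) ^ R / x ^ ((p - 1) * S) * (d t * poly (G t) x)"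
        unfolding t Hx[OF i] Gx[OF i] power_mult_distrib r 1 2 using x(2) by simp
    qed
    also have "\<dots> = (x ^ ((p - 1) * S)) ^ R / x ^ ((p - 1) * S) * poly (\<Sum>t\<in>I. smult (d t) (G t)) x"
      by (simp add: poly_sum sum_distrib_left)
    also have "\<dots> = 0" by (simp add: G0)
    finally show "poly P x = 0" by simp
  qed
  then have "card {x\<in>F (2*m). x \<noteq> 0 \<and> Tr (2*m) (a * x + b / x) = c} \<le> card {x. poly P x = 0}"
    by (intro card_mono poly_roots_finite P0)
  moreover have "S * R = p ^ (2 * m - 1)"
    using m by (simp add: S_def R_def flip: power_add) (simp add: mult_2)
  ultimately show ?thesis using card_poly_roots_bound[OF P0] by (simp add: R_def)
qed


subsection \<open>Kloosterman sums\<close>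

text \<open>Only meaningful on the prime field, where the residue modulo \<open>p\<close> of \<open>t\<close> is determined by \<open>x\<close>.\<close>

definition prime_char :: "'k \<Rightarrow> complex" where
  "prime_char x = cis (2 * pi * real (SOME t. of_nat t = x) / real p)"

definition psi :: "nat \<Rightarrow> 'k \<Rightarrow> complex" where "psi n x = prime_char (Tr n x)"

definition kloosterman :: "nat \<Rightarrow> 'k \<Rightarrow> 'k \<Rightarrow> complex" where
  "kloosterman n a b = (\<Sum>x\<in>F n - {0}. psi n (a * x + b / x))"

text \<open>\<open>SOME\<close> may pick any representative; two of them differ by a multiple of
  \<open>p\<close>, and the angles by full turns.\<close>

lemma prime_char_of_nat: "prime_char (of_nat t) = cis (2 * pi * real t / real p)"
proof -
  have mod: "cis (2 * pi * real s / real p) = cis (2 * pi * real (s mod p) / real p)" for s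
  proof -
    have "real s = real p * real (s div p) + real (s mod p)"
      by (metis mult_div_mod_eq of_nat_add of_nat_mult)
    then have "2 * pi * real s / real p = 2 * pi * real (s div p) + 2 * pi * real (s mod p) / real p"
      by (simp add: field_simps)
    then show ?thesis using cis_multiple_2pi[of "real (s div p)"] by (simp flip: cis_mult)
  qed
  define s where "s = (SOME s. (of_nat s :: 'k) = of_nat t)"
  have "(of_nat s :: 'k) = of_nat t" unfolding s_def by (rule someI) (rule refl)
  then have "s mod p = t mod p"
    by (simp add: of_nat_eq_iff_cong_CHAR cong_def flip: p_eq)
  then show ?thesis unfolding prime_char_def s_def[symmetric] using mod[of s] mod[of t] by simp
qed

lemma prime_char_add:
  assumes "x \<in> F 1" "y \<in> F 1"
  shows "prime_char (x + y) = prime_char x * prime_char y"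
proof -
  obtain s t where "x = of_nat s" "y = of_nat t" using assms unfolding F_1_eq by blast
  moreover have "prime_char (of_nat s + of_nat t) = prime_char (of_nat s) * prime_char (of_nat t)"
    unfolding of_nat_add[symmetric] prime_char_of_nat by (simp add: cis_mult add_divide_distrib distrib_left)
  ultimately show ?thesis by simp
qed

lemma prime_char_0 [simp]: "prime_char 0 = 1"
  using prime_char_of_nat[of 0] by simp

lemma prime_char_neq_1:
  assumes "x \<in> F 1" "x \<noteq> 0"
  shows "prime_char x \<noteq> 1"
proof
  obtain t where t: "t < p" "x = of_nat t" using assms unfolding F_1_eq by blast
  assume "prime_char x = 1"
  then have "cis (2 * pi * real t / real p) = 1" using t prime_char_of_nat by simp
  then have "cos (2 * pi * real t / real p) = 1" by (metis cis.simps(1) one_complex.simps(1))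
  then obtain k :: int where "2 * pi * real t / real p = of_int k * 2 * pi"
    by (auto simp: cos_one_2pi_int)
  then have "real t = of_int k * real p" by (simp add: field_simps)
  then have "int t = k * int p" by (metis of_int_eq_iff of_int_mult of_int_of_nat_eq)
  then have "p dvd t" by (metis dvd_triv_right int_dvd_int_iff)
  then have "t = 0" using t(1) by (auto dest: dvd_imp_le)
  then show False using t assms by simp
qed

lemma norm_prime_char [simp]: "norm (prime_char x) = 1"
  by (simp add: prime_char_def)

lemma psi_add: "x \<in> F n \<Longrightarrow> y \<in> F n \<Longrightarrow> psi n (x + y) = psi n x * psi n y"
  unfolding psi_def Tr_add by (intro prime_char_add Tr_in_F_1)

lemma psi_0 [simp]: "psi n 0 = 1"
  by (simp add: psi_def Tr_def zero_power)

lemma norm_psi [simp]: "norm (psi n x) = 1"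
  by (simp add: psi_def)

text \<open>Translation by an element \<open>y\<close> of nonzero trace multiplies the sum by
  \<open>psi n y\<close>, which is not 1.\<close>

lemma psi_sum_zero:
  assumes "n > 0"
  shows "(\<Sum>x\<in>F n. psi n x) = 0"
proof -
  obtain y where y: "y \<in> F n" "Tr n y \<noteq> 0" using Tr_nontrivial[OF assms] by auto
  have "(\<Sum>x\<in>F n. psi n x) = (\<Sum>x\<in>F n. psi n (x + y))"
    by (rule sum.reindex_bij_witness[of _ "\<lambda>x. x + y" "\<lambda>x. x - y"]) (use y F_closed in auto)
  also have "\<dots> = psi n y * (\<Sum>x\<in>F n. psi n x)"
    unfolding sum_distrib_left using y by (intro sum.cong) (auto simp: psi_add)
  finally have "(psi n y - 1) * (\<Sum>x\<in>F n. psi n x) = 0" by (simp add: algebra_simps)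
  moreover have "psi n y \<noteq> 1" unfolding psi_def using prime_char_neq_1 y Tr_in_F_1 by simp
  ultimately show ?thesis by simp
qed

lemma psi_sum:
  assumes "n > 0" "t \<in> F n"
  shows "(\<Sum>x\<in>F n. psi n (x * t)) = (if t = 0 then of_nat (p ^ n) else 0)"
proof (cases "t = 0")
  case True
  then show ?thesis using card_F[OF assms(1)] by simp
next
  case False
  have "(\<Sum>x\<in>F n. psi n (x * t)) = (\<Sum>x\<in>F n. psi n x)"
    by (rule sum.reindex_bij_witness[of _ "\<lambda>x. x / t" "\<lambda>x. x * t"]) (use assms False F_closed in auto)
  then show ?thesis using False psi_sum_zero[OF assms(1)] by simp
qed

text \<open>Transitivity of the trace: the last n conjugates of z are the first n of
  z^(p^n).\<close>

lemma psi_double: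
  assumes "z \<in> F (2 * n)"
  shows "psi (2 * n) z = psi n (z + z ^ (p ^ n))"
proof -
  have "{..<2*n} = {..<n} \<union> {n..<n+n}" by auto
  then have "Tr (2 * n) z = Tr n z + (\<Sum>i=n..<n+n. z ^ (p ^ i))"
    unfolding Tr_def by (simp add: sum.union_disjoint ivl_disj_int)
  also have "(\<Sum>i=n..<n+n. z ^ (p ^ i)) = (\<Sum>i<n. z ^ (p ^ (i + n)))"
    using sum.shift_bounds_nat_ivl[of "\<lambda>i. z ^ (p ^ i)" 0 n n] by (simp add: lessThan_atLeast0)
  also have "\<dots> = Tr n (z ^ (p ^ n))"
    unfolding Tr_def by (simp add: power_add mult.commute flip: power_mult)
  finally show ?thesis by (simp add: psi_def Tr_add)
qed

section \<open>Pairs with given sum and product, and the doubling relation\<close>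

lemma quadratic_roots:
  fixes s r :: 'k
  obtains x y where "x + y = s" "x * y = r"
    "\<And>x' y'. x' + y' = s \<and> x' * y' = r \<longleftrightarrow> (x', y') = (x, y) \<or> (x', y') = (y, x)"
proof -
  have "degree [:r, -s, 1:] > 0" by simp
  from alg_closed_imp_poly_has_root[OF this] obtain x where "poly [:r, -s, 1:] x = 0" by blast
  then have x: "r = x * (s - x)" by (simp add: algebra_simps eq_neg_iff_add_eq_0)
  have "x' + y' = s \<and> x' * y' = r \<longleftrightarrow> (x', y') = (x, s - x) \<or> (x', y') = (s - x, x)" for x' y'
  proof
    assume *: "x' + y' = s \<and> x' * y' = r"
    then have y': "y' = s - x'" by (metis add_diff_cancel_left')
    have "(x' - x) * (x' - (s - x)) = x * (s - x) - x' * (s - x')" by (simp add: algebra_simps)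
    also have "\<dots> = 0" using * x y' by simp
    finally show "(x', y') = (x, s - x) \<or> (x', y') = (s - x, x)" using y' by auto
  qed (auto simp: x mult.commute)
  then show ?thesis using that[of x "s - x"] x by simp
qed

text \<open>The Frobenius map either fixes or swaps the roots of a monic quadratic, so
  every quadratic with coefficients in the small field is counted twice in total.\<close>

lemma card_quadratic_fibres:
  assumes n: "n > 0" and s: "s \<in> F n" and r: "r \<in> F n" "r \<noteq> 0"
  shows "card {t \<in> (F n - {0}) \<times> (F n - {0}). (fst t + snd t, fst t * snd t) = (s, r)} +
         card {z \<in> F (2 * n) - {0}. (z + z ^ (p ^ n), z * z ^ (p ^ n)) = (s, r)} = 2" (is "card ?A + card ?B = 2")
proof -
  obtain x y where xy: "x + y = s" "x * y = r" and
    iff: "\<And>x' y'. x' + y' = s \<and> x' * y' = r \<longleftrightarrow> (x', y') = (x, y) \<or> (x', y') = (y, x)"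
    using quadratic_roots[of s r] by metis
  define Q where "Q = p ^ n"
  have nz: "x \<noteq> 0" "y \<noteq> 0" using xy r by auto
  have F: "z \<in> F n \<longleftrightarrow> z ^ Q = z" for z by (simp add: F_def Q_def)
  have F2: "z \<in> F (2 * n) \<longleftrightarrow> (z ^ Q) ^ Q = z" for z
    by (simp add: F_def Q_def mult_2 power_add flip: power_mult)
  have "x ^ Q + y ^ Q = s" "x ^ Q * y ^ Q = r"
    using s r xy unfolding F Q_def by (simp_all flip: frob_add power_mult_distrib)
  then have cases: "x ^ Q = x \<and> y ^ Q = y \<or> x ^ Q = y \<and> y ^ Q = x"
    using iff[of "x ^ Q" "y ^ Q"] by simp
  have A: "?A = {t. (t = (x, y) \<or> t = (y, x)) \<and> x ^ Q = x \<and> y ^ Q = y}"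
  proof (rule Set.set_eqI)
    fix t :: "'k \<times> 'k"
    obtain x' y' where t: "t = (x', y')" by (cases t)
    have "t \<in> ?A \<longleftrightarrow> (x' \<in> F n - {0} \<and> y' \<in> F n - {0}) \<and> ((x', y') = (x, y) \<or> (x', y') = (y, x))"
      unfolding iff[symmetric] t by simp
    also have "\<dots> \<longleftrightarrow> t \<in> {t. (t = (x, y) \<or> t = (y, x)) \<and> x ^ Q = x \<and> y ^ Q = y}"
      unfolding t using nz F by auto
    finally show "t \<in> ?A \<longleftrightarrow> t \<in> {t. (t = (x, y) \<or> t = (y, x)) \<and> x ^ Q = x \<and> y ^ Q = y}" .
  qed
  have B: "?B = {z. (z = x \<and> x ^ Q = y \<or> z = y \<and> y ^ Q = x) \<and> (z ^ Q) ^ Q = z}"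
    unfolding Q_def[symmetric] prod.inject iff using nz by (auto simp: F2)
  show ?thesis
  proof (cases "x = y")
    \<comment> \<open>A double root is fixed by Frobenius and counts once on either side.\<close>
    case True
    then have A': "?A = {(x, y)}" and B': "?B = {x}" unfolding A B using cases by auto
    show ?thesis unfolding A' B' by simp
  next
    case False
    show ?thesis
    proof (cases "x ^ Q = x")
      case True
      then have "y ^ Q = y" using cases False by auto
      then have A': "?A = {(x, y), (y, x)}" and B': "?B = {}" unfolding A B using True False by auto
      show ?thesis unfolding A' B' using False by simp
    next
      case False': False
      then have "x ^ Q = y" "y ^ Q = x" using cases by auto
      then have A': "?A = {}" and B': "?B = {x, y}" unfolding A B using False by auto
      show ?thesis unfolding A' B' using False by simp
    qed
  qed
qed

text \<open>Pairs (x, y) index the square, and elements z with their conjugates z^(p^n) index the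
  sum over the larger field. In both the summand depends only on the sum s and the product r, its
  argument being a s + b s / r. Every (s, r) occurs twice in all, so together they form twice a sum
  over all s and all nonzero r.\<close>

lemma kloosterman_double:
  assumes n: "n > 0" and a: "a \<in> F n" "a \<noteq> 0" and b: "b \<in> F n" "b \<noteq> 0"
  shows "kloosterman n a b ^ 2 + kloosterman (2 * n) a b = 2 * of_nat (p ^ n)"
proof -
  define Q where "Q = p ^ n"
  define A where "A = (F n - {0}) \<times> (F n - {0})"
  define B where "B = F (2 * n) - {0}"
  define T where "T = F n \<times> (F n - {0})"
  define g where "g = (\<lambda>(s, r). psi n (a * s + b * s / r))"
  define f1 where "f1 t = (fst t + snd t, fst t * snd t)" for t :: "'k \<times> 'k"
  define f2 where "f2 z = (z + z ^ Q, z * z ^ Q)" for z :: 'k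
  have fin: "finite (F n)" "finite (F (2 * n))" using card_F n by auto
  have finA: "finite A" and finB: "finite B" and finT: "finite T"
    using fin by (auto simp: A_def B_def T_def)
  have F2: "z \<in> F (2 * n) \<longleftrightarrow> (z ^ Q) ^ Q = z" for z
    by (simp add: F_def Q_def mult_2 power_add flip: power_mult)
  have "kloosterman n a b ^ 2 = (\<Sum>t\<in>A. psi n (a * fst t + b / fst t) * psi n (a * snd t + b / snd t))"
    unfolding kloosterman_def power2_eq_square sum_product A_def by (simp add: sum.cartesian_product case_prod_unfold)
  also have "\<dots> = (\<Sum>t\<in>A. g (f1 t))"
  proof (intro sum.cong refl)
    fix t assume "t \<in> A"
    then obtain x y where t: "t = (x, y)" and xy: "x \<in> F n" "y \<in> F n" "x \<noteq> 0" "y \<noteq> 0"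
      by (auto simp: A_def)
    have "psi n (a * x + b / x) * psi n (a * y + b / y) = psi n (a * x + b / x + (a * y + b / y))"
      using a b xy F_closed by (intro psi_add[symmetric]) auto
    also have "a * x + b / x + (a * y + b / y) = a * (x + y) + b * (x + y) / (x * y)"
      using xy by (simp add: field_simps)
    finally show "psi n (a * fst t + b / fst t) * psi n (a * snd t + b / snd t) = g (f1 t)"
      by (simp add: t g_def f1_def)
  qed
  also have "\<dots> = (\<Sum>u\<in>T. \<Sum>t\<in>{t \<in> A. f1 t = u}. g (f1 t))"
    using finA finT by (intro sum.group[symmetric]) (auto simp: A_def T_def f1_def F_closed(1,3))
  finally have 1: "kloosterman n a b ^ 2 = (\<Sum>u\<in>T. of_nat (card {t \<in> A. f1 t = u}) * g u)" by simp
  have "kloosterman (2 * n) a b = (\<Sum>z\<in>B. g (f2 z))"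
    unfolding kloosterman_def B_def
  proof (intro sum.cong refl)
    fix z assume z: "z \<in> F (2 * n) - {0}"
    have ab: "a \<in> F (2 * n)" "b \<in> F (2 * n)" using a b F_mono_dvd[of n "2 * n"] by auto
    have "a ^ Q = a" "b ^ Q = b" using a b by (auto simp: F_def Q_def)
    then have "(a * z + b / z) ^ Q = a * z ^ Q + b / z ^ Q"
      unfolding Q_def by (simp add: frob_add power_mult_distrib power_divide)
    moreover have "psi (2 * n) (a * z + b / z) = psi n (a * z + b / z + (a * z + b / z) ^ Q)"
      unfolding Q_def using ab z F_closed by (intro psi_double) auto
    moreover have "a * z + b / z + (a * z ^ Q + b / z ^ Q) = a * (z + z ^ Q) + b * (z + z ^ Q) / (z * z ^ Q)"
      using z by (simp add: field_simps)
    ultimately show "psi (2 * n) (a * z + b / z) = g (f2 z)"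
      by (simp add: g_def f2_def)
  qed
  also have "\<dots> = (\<Sum>u\<in>T. \<Sum>z\<in>{z \<in> B. f2 z = u}. g (f2 z))"
  proof (intro sum.group[symmetric] finB finT image_subsetI)
    fix z assume "z \<in> B"
    then have z: "(z ^ Q) ^ Q = z" "z \<noteq> 0" by (auto simp: B_def F2)
    have "(z + z ^ Q) ^ Q = z ^ Q + (z ^ Q) ^ Q" unfolding Q_def by (rule frob_add)
    then have "z + z ^ Q \<in> F n" using z by (simp add: F_def add.commute flip: Q_def)
    moreover have "z * z ^ Q \<in> F n"
      using z by (simp add: F_def power_mult_distrib mult.commute flip: Q_def)
    ultimately show "f2 z \<in> T" using z by (simp add: T_def f2_def)
  qed
  finally have 2: "kloosterman (2 * n) a b = (\<Sum>u\<in>T. of_nat (card {z \<in> B. f2 z = u}) * g u)" by simp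
  have "kloosterman n a b ^ 2 + kloosterman (2 * n) a b = (\<Sum>u\<in>T. 2 * g u)"
    unfolding 1 2 sum.distrib[symmetric]
  proof (intro sum.cong refl)
    fix u assume "u \<in> T"
    then obtain s r where u: "u = (s, r)" "s \<in> F n" "r \<in> F n" "r \<noteq> 0" by (auto simp: T_def)
    have "card {t \<in> A. f1 t = u} + card {z \<in> B. f2 z = u} = 2"
      unfolding A_def B_def f1_def f2_def Q_def u(1) by (rule card_quadratic_fibres[OF n u(2-4)])
    then show "of_nat (card {t \<in> A. f1 t = u}) * g u + of_nat (card {z \<in> B. f2 z = u}) * g u = 2 * g u"
      unfolding distrib_right[symmetric] of_nat_add[symmetric] by simp
  qed
  also have "\<dots> = 2 * (\<Sum>r\<in>F n - {0}. \<Sum>s\<in>F n. g (s, r))"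
    unfolding T_def sum_distrib_left[symmetric] by (subst sum.swap) (simp add: sum.cartesian_product)
  \<comment> \<open>Orthogonality in s leaves the single product r = - b / a.\<close>
  also have "(\<Sum>r\<in>F n - {0}. \<Sum>s\<in>F n. g (s, r)) = (\<Sum>r\<in>F n - {0}. if r = - b / a then of_nat (p ^ n) else 0)"
  proof (intro sum.cong refl)
    fix r assume r: "r \<in> F n - {0}"
    have "(\<Sum>s\<in>F n. g (s, r)) = (\<Sum>s\<in>F n. psi n (s * (a + b / r)))"
      by (simp add: g_def algebra_simps)
    also have "\<dots> = (if a + b / r = 0 then of_nat (p ^ n) else 0)"
      using a b r F_closed by (intro psi_sum n) auto
    also have "a + b / r = 0 \<longleftrightarrow> r = - b / a"
      using a r by (auto simp: field_simps add_eq_0_iff)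
    finally show "(\<Sum>s\<in>F n. g (s, r)) = (if r = - b / a then of_nat (p ^ n) else 0)" .
  qed
  also have "\<dots> = of_nat (p ^ n)"
    using fin a b F_closed by (simp add: sum.delta)
  finally show ?thesis .
qed

text \<open>Grouping by trace values gives a sum over the prime field, where subtracting the
  constant \<open>q\<close> from all fibre sizes changes nothing. Upper bounds for the deviations,
  whose total is -1, also bound their absolute values. The factor \<open>p\<close> lost here is
  harmless because it stays fixed while \<open>m\<close> grows.\<close>

lemma kloosterman_weak_bound:
  assumes m: "m > 0" and a: "a \<in> F (2 * m)" "a \<noteq> 0" and b: "b \<in> F (2 * m)"
  shows "norm (kloosterman (2 * m) a b) \<le> 13 * real p * real p ^ m"
proof -
  define q where "q = real p ^ (2 * m - 1)"
  define M where "M c = real (card {x\<in>F (2*m). x \<noteq> 0 \<and> Tr (2*m) (a * x + b / x) = c})" for c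
  have fin: "finite (F (2 * m))" "finite (F 1)" and card: "card (F (2 * m)) = p ^ (2 * m)" "card (F 1) = p"
    using card_F m by auto
  have M: "M c - q \<le> 6 * real p ^ m" for c
  proof -
    have "M c \<le> real (p ^ (2*m-1) + 6 * p ^ m)"
      unfolding M_def of_nat_le_iff using card_trace_fibre_le[OF a(2) m, of b c] by simp
    then show ?thesis by (simp add: q_def)
  qed
  have inF: "a * x + b / x \<in> F (2 * m)" if "x \<in> F (2 * m)" for x
    using a b that F_closed by auto
  have group: "(\<Sum>c\<in>F 1. \<Sum>x\<in>{x \<in> F (2*m) - {0}. Tr (2*m) (a * x + b / x) = c}. h x) = (\<Sum>x\<in>F (2*m) - {0}. h x)"
    for h :: "'k \<Rightarrow> complex"
    using fin inF Tr_in_F_1 by (intro sum.group) auto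
  have set: "{x \<in> F (2*m) - {0}. Tr (2*m) (a * x + b / x) = c} = {x\<in>F (2*m). x \<noteq> 0 \<and> Tr (2*m) (a * x + b / x) = c}" for c
    by auto
  have "complex_of_real (\<Sum>c\<in>F 1. M c) = of_nat (p ^ (2 * m) - 1)"
    using group[of "\<lambda>_. 1"] fin card by (simp add: M_def set card_Diff_singleton)
  then have "(\<Sum>c\<in>F 1. M c) = real (p ^ (2 * m) - 1)"
    by (metis of_real_eq_iff of_real_of_nat_eq)
  moreover have "real p * q = real p ^ (2 * m)"
    using m by (simp add: q_def flip: power_Suc)
  moreover have "real (p ^ (2 * m) - 1) = real p ^ (2 * m) - 1"
    by (subst of_nat_diff) (use p_pos in \<open>auto simp: Suc_leI\<close>)
  \<comment> \<open>The -1 stems from the omitted point 0.\<close>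
  ultimately have sumM: "(\<Sum>c\<in>F 1. M c - q) = -1"
    using card by (simp add: sum_subtractf)
  have "kloosterman (2 * m) a b = (\<Sum>c\<in>F 1. of_real (M c) * prime_char c)"
    unfolding kloosterman_def psi_def group[symmetric]
    by (intro sum.cong refl) (simp add: M_def set)
  moreover have "(\<Sum>c\<in>F 1. of_real q * prime_char c) = 0"
    using psi_sum_zero[of 1] by (simp add: psi_def Tr_def flip: sum_distrib_left)
  ultimately have "kloosterman (2 * m) a b = (\<Sum>c\<in>F 1. of_real (M c - q) * prime_char c)"
    by (simp add: algebra_simps sum_subtractf)
  also have "norm \<dots> \<le> (\<Sum>c\<in>F 1. \<bar>M c - q\<bar>)"
    by (rule order_trans[OF norm_sum]) (simp add: norm_mult del: of_real_diff)
  \<comment> \<open>If t \<le> 6 T and T \<ge> 0, then |t| \<le> 12 T - t; for positive t this is 2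
    t \<le> 12 T.\<close>
  also have "\<dots> \<le> (\<Sum>c\<in>F 1. 12 * real p ^ m - (M c - q))"
  proof (intro sum_mono)
    fix c
    have "0 \<le> real p ^ m" by simp
    then show "\<bar>M c - q\<bar> \<le> 12 * real p ^ m - (M c - q)" using M[of c] by linarith
  qed
  also have "\<dots> = 12 * real p * real p ^ m + 1"
    unfolding sum_subtractf[of _ "\<lambda>c. M c - q"] sumM using card by simp
  also have "\<dots> \<le> 13 * real p * real p ^ m"
  proof -
    have "1 \<le> real p * real p ^ m"
      using p_pos by (intro mult_ge1_I one_le_power) (auto simp: Suc_leI)
    then show ?thesis by linarith
  qed
  finally show ?thesis .
qed

text \<open>Normalised by the square root of the field size, the absolute values along the degrees
  2^j n satisfy y (j+1) \<ge> (y j)^2 - 2. As 2 is a repelling fixed point of t^2 - 2, an excess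
  over 2 at least quadruples at each step and would pass the fixed bound 13 p.\<close>

lemma kloosterman_bound:
  assumes n: "n > 0" and a: "a \<in> F n" "a \<noteq> 0" and b: "b \<in> F n" "b \<noteq> 0"
  shows "norm (kloosterman n a b) \<le> 2 * sqrt (real p ^ n)"
proof (rule ccontr)
  assume contr: "\<not> ?thesis"
  define N where "N j = 2 ^ j * n" for j
  define y where "y j = norm (kloosterman (N j) a b) / sqrt (real p ^ N j)" for j
  define \<delta> where "\<delta> = y 0 - 2"
  have pos: "sqrt (real p ^ N j) > 0" for j by simp
  have \<delta>: "\<delta> > 0"
    using contr pos[of 0] by (simp add: \<delta>_def y_def N_def field_simps)
  have N: "N j > 0" "n dvd N j" for j using n by (auto simp: N_def)
  have ab: "a \<in> F (N j)" "b \<in> F (N j)" for j using a b F_mono_dvd[OF N(2)] by auto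
  have step: "y (Suc j) \<ge> y j ^ 2 - 2" for j
  proof -
    have NS: "N (Suc j) = 2 * N j" by (simp add: N_def)
    have "kloosterman (N (Suc j)) a b = 2 * of_nat (p ^ N j) - kloosterman (N j) a b ^ 2"
      using kloosterman_double[OF N(1) ab(1) a(2) ab(2) b(2), of j] by (simp add: NS algebra_simps)
    then have "norm (kloosterman (N (Suc j)) a b) \<ge> norm (kloosterman (N j) a b) ^ 2 - 2 * real p ^ N j"
      using norm_triangle_ineq3[of "2 * complex_of_nat (p ^ N j)" "kloosterman (N j) a b ^ 2"]
      by (simp add: norm_power norm_mult)
    moreover have "sqrt (real p ^ N (Suc j)) = real p ^ N j"
      unfolding NS power_even_eq real_sqrt_abs by simp
    ultimately have "y (Suc j) \<ge> (norm (kloosterman (N j) a b) ^ 2 - 2 * real p ^ N j) / real p ^ N j"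
      unfolding y_def by (simp add: divide_right_mono)
    also have "(norm (kloosterman (N j) a b) ^ 2 - 2 * real p ^ N j) / real p ^ N j = y j ^ 2 - 2"
    proof -
      have sq: "(sqrt (real p ^ N j))\<^sup>2 = real p ^ N j" by (rule real_sqrt_pow2) simp
      show ?thesis unfolding y_def power_divide sq using p_pos by (simp add: diff_divide_distrib)
    qed
    finally show ?thesis .
  qed
  have grow: "y j \<ge> 2 + 4 ^ j * \<delta>" for j
  proof (induction j)
    case 0 then show ?case by (simp add: \<delta>_def)
  next
    case (Suc j)
    have "0 \<le> 2 + 4 ^ j * \<delta>" using \<delta> by simp
    then have "(2 + 4 ^ j * \<delta>) ^ 2 \<le> y j ^ 2" using Suc.IH by (intro power_mono) auto
    moreover have "(2 + 4 ^ j * \<delta>) ^ 2 = 4 + 4 * (4 ^ j * \<delta>) + (4 ^ j * \<delta>) ^ 2"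
      by (simp add: power2_eq_square algebra_simps)
    moreover have "0 \<le> (4 ^ j * \<delta>) ^ 2" by simp
    ultimately have "y j ^ 2 - 2 \<ge> 2 + 4 * (4 ^ j * \<delta>)" by linarith
    then show ?case using step[of j] by simp
  qed
  \<comment> \<open>The weak bound concerns even degrees, hence the index
    \<open>Suc j\<close>.\<close>
  have bound: "y (Suc j) \<le> 13 * real p" for j
  proof -
    have NS: "N (Suc j) = 2 * N j" by (simp add: N_def)
    have "sqrt (real p ^ N (Suc j)) = real p ^ N j"
      unfolding NS power_even_eq real_sqrt_abs by simp
    moreover have "norm (kloosterman (N (Suc j)) a b) \<le> 13 * real p * real p ^ N j"
      unfolding NS using ab[of "Suc j"] a(2) by (intro kloosterman_weak_bound N) (auto simp: NS)
    ultimately show ?thesis by (simp add: y_def field_simps)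
  qed
  obtain j where "13 * real p / \<delta> < 4 ^ j"
    using real_arch_pow[of 4 "13 * real p / \<delta>"] by auto
  then have "13 * real p < 4 ^ j * \<delta>" using \<delta> by (simp add: field_simps)
  also have "\<dots> \<le> 4 ^ Suc j * \<delta>" using \<delta> by simp
  also have "\<dots> \<le> y (Suc j)" using grow[of "Suc j"] by linarith
  finally show False using bound[of j] by simp
qed

end

subsection \<open>Transfer to a finite field\<close>

text \<open>Multiplication by a nonzero \<open>x\<close> permutes the nonzero elements; compare
  their products.\<close>

lemma finite_field_power_card:
  fixes x :: "'a::{field,finite}"
  shows "x ^ CARD('a) = x"
proof (cases "x = 0")
  case False
  have "(\<Prod>y\<in>UNIV - {0}. y) = (\<Prod>y\<in>UNIV - {0}. x * y)"
    by (rule prod.reindex_bij_witness[of _ "\<lambda>y. x * y" "\<lambda>y. y / x"]) (use False in auto)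
  also have "\<dots> = x ^ (CARD('a) - 1) * (\<Prod>y\<in>UNIV - {0}. y)"
    by (simp add: prod.distrib card_Diff_singleton)
  finally have "x ^ (CARD('a) - 1) = 1" by simp
  then have "x ^ Suc (CARD('a) - 1) = x" by (simp only: power_Suc mult_1_right)
  moreover have "Suc (CARD('a) - 1) = CARD('a)" by (simp add: Suc_diff_1[OF zero_less_card_finite] del: One_nat_def)
  ultimately show ?thesis by metis
qed simp

context odd_char_closed_field
begin

lemma infinite_closed_field: "infinite (UNIV :: 'k set)"
proof
  assume fin: "finite (UNIV :: 'k set)"
  define n where "n = Suc (CARD('k))"
  have "p ^ n \<le> CARD('k)"
    using card_F[of n] card_mono[OF fin, of "F n"] by (simp add: n_def)
  moreover have "n < 2 ^ n" by simp
  moreover have "2 ^ n \<le> p ^ n" using p_gt_2 by (intro power_mono) auto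
  ultimately show False by (simp add: n_def)
qed

text \<open>The hypotheses give \<open>(X + 1)\<^sup>q = X\<^sup>q + 1\<close>; writing
  \<open>q = p\<^sup>k m\<close> with \<open>p\<close> not dividing \<open>m\<close> this forces \<open>(Y + 1)\<^sup>m = Y\<^sup>m + 1\<close> and the
  derivative at 0 gives \<open>m = 1\<close>.\<close>

lemma frobenius_fixed_card_prime_power:
  fixes A :: "'k set"
  assumes A: "finite A" "1 < card A" "\<And>x. x \<in> A \<Longrightarrow> x ^ card A = x" "\<And>x. x \<in> A \<Longrightarrow> x + 1 \<in> A"
  shows "\<exists>k>0. card A = p ^ k"
proof -
  define q where "q = card A"
  define P :: "'k poly" where "P = [:1, 1:] ^ q - monom 1 q - 1"
  have q0: "q \<noteq> 0" using A(2) unfolding q_def by linarith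
  \<comment> \<open>The leading terms cancel, so a nonzero \<open>P\<close> would have degree below
    q, yet it vanishes at all q elements of \<open>A\<close>.\<close>
  have P0: "P = 0"
  proof (rule ccontr)
    assume "P \<noteq> 0"
    have "degree P \<le> q"
      using degree_power_le[of "[:1, 1 :: 'k:]" q] degree_monom_le[of "1 :: 'k" q]
      unfolding P_def by (intro degree_diff_le) simp_all
    moreover have "coeff ([:1, 1 :: 'k:] ^ q) q = 1"
      using lead_coeff_power[of "[:1, 1 :: 'k:]" q] by (simp add: degree_power_eq)
    then have "coeff P q = 0" using q0 by (simp add: P_def)
    ultimately have "degree P < q" using \<open>P \<noteq> 0\<close> by (metis le_neq_implies_less leading_coeff_0_iff)
    moreover have "A \<subseteq> {x. poly P x = 0}"
    proof
      fix x assume x: "x \<in> A"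
      have "(x + 1) ^ q = x ^ q + 1" using A(3)[OF x] A(3)[OF A(4)[OF x]] by (simp add: q_def)
      then show "x \<in> {x. poly P x = 0}" by (simp add: P_def poly_monom poly_power add.commute)
    qed
    then have "q \<le> card {x. poly P x = 0}"
      unfolding q_def by (intro card_mono poly_roots_finite \<open>P \<noteq> 0\<close>)
    ultimately show False using card_poly_roots_bound[OF \<open>P \<noteq> 0\<close>] by linarith
  qed
  from q0 obtain m where m: "q = p ^ multiplicity p q * m" "\<not> p dvd m"
    using multiplicity_decompose'[of q p] prime_p by (metis not_prime_unit)
  define k where "k = multiplicity p q"
  have qk: "q = p ^ k * m" unfolding k_def by (rule m(1))
  \<comment> \<open>Every y has a p^k-th root x in the closed field, and the identity for x and q
    becomes the one for y and m.\<close>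
  have *: "(y + 1) ^ m = y ^ m + 1" for y :: 'k
  proof -
    obtain x where x: "x ^ (p ^ k) = y" using nth_root_exists[of "p ^ k" y] by auto
    have "poly P x = 0" by (simp add: P0)
    then have "(x + 1) ^ q - x ^ q - 1 = 0" by (simp add: P_def poly_power poly_monom add.commute)
    then have "(x + 1) ^ q = x ^ q + 1" by (simp only: right_minus_eq diff_diff_eq)
    then have "((x + 1) ^ (p ^ k)) ^ m = (x ^ (p ^ k)) ^ m + 1"
      unfolding qk by (simp add: power_mult)
    then show ?thesis by (simp add: frob_add x)
  qed
  define D :: "'k poly" where "D = [:1, 1:] ^ m - monom 1 m - 1"
  have "{x. poly D x = 0} = UNIV"
    using * by (auto simp: D_def poly_power poly_monom add.commute)
  then have "D = 0" using poly_roots_finite[of D] infinite_closed_field by auto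
  then have "poly (pderiv D) 0 = 0" by simp
  moreover have "poly (pderiv D) 0 = of_nat m - of_nat m * 0 ^ (m - 1)"
    by (simp add: D_def pderiv_diff pderiv_power pderiv_monom poly_monom poly_power pderiv_pCons)
  ultimately have "(of_nat m :: 'k) * (1 - 0 ^ (m - 1)) = 0" by (simp add: algebra_simps)
  moreover have "(of_nat m :: 'k) \<noteq> 0" using m(2) p_eq by (simp add: of_nat_eq_0_iff_char_dvd)
  \<comment> \<open>The power of 0 is 1 only if m - 1 = 0. With truncated subtraction this includes
    m = 0, which is excluded because p does not divide m.\<close>
  ultimately have "(0::'k) ^ (m - 1) = 1" by simp
  then have "m - 1 = 0" by (metis power_0_left zero_neq_one)
  moreover have "m \<noteq> 0" using m(2) by (metis dvd_0_right)
  ultimately have "m = 1" by linarith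
  then have "q = p ^ k" using qk by simp
  moreover have "k > 0" 
  proof (rule ccontr)
    assume "\<not> k > 0"
    then have "q = 1" using \<open>q = p ^ k\<close> by simp
    then show False using A(2) unfolding q_def by linarith
  qed
  ultimately show ?thesis unfolding q_def by blast
qed

end

text \<open>This collects what the rest of the argument takes from the closed field: odd
  characteristic and an additive character with its Kloosterman bound. Nontriviality is expressed by
  the vanishing of the complete sum.\<close>

locale kloosterman_character =
  fixes \<psi> :: "'a::{field,finite} \<Rightarrow> complex"
  assumes psi_add: "\<psi> (x + y) = \<psi> x * \<psi> y"
    and norm_psi [simp]: "norm (\<psi> x) = 1"
    and psi_sum_zero: "(\<Sum>x\<in>UNIV. \<psi> x) = 0"
    and two_neq_0: "(2::'a) \<noteq> 0"
    and kloosterman_bound: "a \<noteq> 0 \<Longrightarrow> b \<noteq> 0 \<Longrightarrow>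
          norm (\<Sum>x\<in>UNIV - {0}. \<psi> (a * x + b / x)) \<le> 2 * sqrt (real CARD('a))"

text \<open>The field embeds into its algebraic closure, where its image is closed under adding 1
  and consists of solutions of x^q = x. Hence q is a power p^k, the image is all of
  \<open>F k\<close> by counting, and the character and its bound pull back.\<close>

lemma ex_kloosterman_character:
  assumes odd: "odd CARD('a::{field,finite})"
  shows "\<exists>\<psi> :: 'a \<Rightarrow> complex. kloosterman_character \<psi>"
proof -
  have CHAR: "prime CHAR('a)"
    using prime_CHAR_semidom[where ?'a = 'a] finite_imp_CHAR_pos[where ?'a = 'a] by simp
  have "CHAR('a) dvd CARD('a)" by (rule CHAR_dvd_CARD)
  then have oddC: "odd CHAR('a)" using odd by (meson dvd_trans)
  interpret odd_char_closed_field "CHAR('a)" "TYPE('a alg_closure)"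
    using CHAR oddC by unfold_locales simp_all
  define A where "A = range (to_ac :: 'a \<Rightarrow> _)"
  have cardA: "card A = CARD('a)" unfolding A_def by (intro card_image inj_to_ac)
  have "1 < CARD('a)"
    using card_mono[of UNIV "{0, 1 :: 'a}"] by simp
  moreover have "x + 1 \<in> A" if "x \<in> A" for x
  proof -
    obtain y :: 'a where "x = to_ac y" using \<open>x \<in> A\<close> by (auto simp: A_def)
    then have "x + 1 = to_ac (y + 1)" by simp
    then show ?thesis unfolding A_def by (rule range_eqI)
  qed
  moreover have fix_A: "x ^ card A = x" if "x \<in> A" for x
  proof -
    obtain y :: 'a where "x = to_ac y" using \<open>x \<in> A\<close> by (auto simp: A_def)
    then show ?thesis unfolding cardA by (simp add: finite_field_power_card flip: to_ac_power)
  qed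
  ultimately obtain k where k: "k > 0" "CARD('a) = CHAR('a) ^ k"
    using frobenius_fixed_card_prime_power[of A] cardA by (auto simp: A_def)
  have AF: "A = F k"
    using card_F[OF k(1)] cardA k(2) fix_A by (intro card_subset_eq) (auto simp: F_def)
  have inF: "to_ac x \<in> F k" for x :: 'a using AF by (auto simp: A_def)
  have sum_A: "(\<Sum>x\<in>UNIV. h (to_ac x)) = (\<Sum>x\<in>F k. h x)" for h :: "'a alg_closure \<Rightarrow> complex"
    unfolding AF[symmetric] A_def sum.reindex[OF inj_to_ac] by simp
  have sum_A0: "(\<Sum>x\<in>UNIV - {0}. h (to_ac x)) = (\<Sum>x\<in>F k - {0}. h x)" for h :: "'a alg_closure \<Rightarrow> complex"
    using sum_A[of h] card_F[OF k(1)] by (simp add: sum_diff1)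
  define \<psi> where "\<psi> x = psi k (to_ac x)" for x :: 'a
  have "kloosterman_character \<psi>"
  proof
    fix x y a b :: 'a
    show "\<psi> (x + y) = \<psi> x * \<psi> y" using inF by (simp add: \<psi>_def psi_add)
    show "norm (\<psi> x) = 1" by (simp add: \<psi>_def)
    show "(\<Sum>x\<in>UNIV. \<psi> x) = 0" unfolding \<psi>_def sum_A using psi_sum_zero[OF k(1)] .
    show "(2::'a) \<noteq> 0" using two_neq_0 by (metis to_ac_0 to_ac_numeral)
    assume ab: "a \<noteq> 0" "b \<noteq> 0"
    have "(\<Sum>x\<in>UNIV - {0}. \<psi> (a * x + b / x)) = kloosterman k (to_ac a) (to_ac b)"
      unfolding \<psi>_def kloosterman_def sum_A0[symmetric] by simp
    then show "norm (\<Sum>x\<in>UNIV - {0}. \<psi> (a * x + b / x)) \<le> 2 * sqrt (real CARD('a))"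
      using kloosterman_bound[OF k(1) inF _ inF, of a b] ab k(2) by simp
  qed
  then show ?thesis by blast
qed

subsection \<open>Gauss and Salie sums\<close>

text \<open>Distributivity, with vectors as the choice functions; it splits character sums over
  F_q^d into one-dimensional ones.\<close>

lemma sum_vec_prod:
  fixes f :: "'d::finite \<Rightarrow> 'a::finite \<Rightarrow> 'b::comm_ring_1"
  shows "(\<Sum>v\<in>(UNIV :: ('a ^ 'd) set). \<Prod>i\<in>UNIV. f i (v $ i)) = (\<Prod>i\<in>UNIV. \<Sum>z\<in>UNIV. f i z)"
proof -
  have "(\<Prod>i\<in>UNIV. \<Sum>z\<in>UNIV. f i z) = (\<Sum>g\<in>UNIV. \<Prod>i\<in>UNIV. f i (g i))"
    by (subst prod_sum_PiE) (simp_all add: PiE_UNIV_domain)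
  also have "\<dots> = (\<Sum>v\<in>(UNIV :: ('a ^ 'd) set). \<Prod>i\<in>UNIV. f i (v $ i))"
    by (rule sum.reindex_bij_witness[of _ vec_nth vec_lambda]) auto
  finally show ?thesis by simp
qed

context kloosterman_character
begin

lemma psi_nonzero: "\<psi> x \<noteq> 0"
  by (metis norm_psi norm_zero zero_neq_one)

lemma psi_0 [simp]: "\<psi> 0 = 1"
proof -
  have "\<psi> 0 * \<psi> 0 = \<psi> 0 * 1" using psi_add[of 0 0] by simp
  then show ?thesis using psi_nonzero[of 0] by simp
qed

lemma psi_minus: "\<psi> (- x) = cnj (\<psi> x)"
proof -
  have "\<psi> x * \<psi> (- x) = \<psi> x * cnj (\<psi> x)"
    unfolding complex_norm_square[symmetric] psi_add[symmetric] by simp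
  then show ?thesis using psi_nonzero[of x] by simp
qed

lemma psi_sum: "(\<Sum>x\<in>UNIV. \<psi> (x * t)) = (if t = 0 then of_nat CARD('a) else 0)"
proof (cases "t = 0")
  case False
  have "(\<Sum>x\<in>UNIV. \<psi> (x * t)) = (\<Sum>x\<in>UNIV. \<psi> x)"
    by (rule sum.reindex_bij_witness[of _ "\<lambda>x. x / t" "\<lambda>x. x * t"]) (use False in auto)
  then show ?thesis using False psi_sum_zero by simp
qed simp

lemma psi_sum_nonzero: "(\<Sum>x\<in>UNIV - {0}. \<psi> (x * t)) = (if t = 0 then of_nat CARD('a) else 0) - 1"
  using psi_sum[of t] by (simp add: sum_diff1)

lemma psi_of_sum: "finite I \<Longrightarrow> \<psi> (\<Sum>i\<in>I. f i) = (\<Prod>i\<in>I. \<psi> (f i))"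
  by (induction I rule: finite_induct) (simp_all add: psi_add)

text \<open>The quadratic Gauss sum. For nonzero \<open>j\<close> it varies with \<open>j\<close>
  only by a sign, and so takes the place of the quadratic character below.\<close>

definition gauss :: "'a \<Rightarrow> complex" where "gauss j = (\<Sum>z\<in>UNIV. \<psi> (j * z ^ 2))"

lemma gauss_shift: "(\<Sum>z\<in>UNIV. \<psi> (j * (z + c) ^ 2)) = gauss j"
  unfolding gauss_def
  by (rule sum.reindex_bij_witness[of _ "\<lambda>z. z - c" "\<lambda>z. z + c"]) auto

lemma gauss_minus: "gauss (- j) = cnj (gauss j)"
  by (simp add: gauss_def psi_minus)

text \<open>Substituting z = h + w in j (z^2 - w^2) leaves j h^2 + 2 j h w, which is linear in w;
  orthogonality keeps only h = 0.\<close>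

lemma gauss_mult_minus:
  assumes "j \<noteq> 0"
  shows "gauss j * gauss (- j) = of_nat CARD('a)"
proof -
  have "gauss j * gauss (- j) = (\<Sum>w\<in>UNIV. \<psi> (- j * w ^ 2) * gauss j)"
    unfolding gauss_def[of "- j"] sum_distrib_left by (simp only: mult.commute)
  also have "\<dots> = (\<Sum>w\<in>UNIV. \<Sum>h\<in>UNIV. \<psi> (j * h ^ 2) * \<psi> (w * (2 * j * h)))"
  proof (intro sum.cong refl)
    fix w :: 'a
    have "\<psi> (- j * w ^ 2) * gauss j = (\<Sum>h\<in>UNIV. \<psi> (- j * w ^ 2) * \<psi> (j * (h + w) ^ 2))"
      unfolding gauss_shift[of j w, symmetric] by (rule sum_distrib_left)
    also have "\<dots> = (\<Sum>h\<in>UNIV. \<psi> (j * h ^ 2) * \<psi> (w * (2 * j * h)))"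
      unfolding psi_add[symmetric] by (simp add: power2_eq_square algebra_simps)
    finally show "\<psi> (- j * w ^ 2) * gauss j = (\<Sum>h\<in>UNIV. \<psi> (j * h ^ 2) * \<psi> (w * (2 * j * h)))" .
  qed
  also have "\<dots> = (\<Sum>h\<in>UNIV. \<psi> (j * h ^ 2) * (\<Sum>w\<in>UNIV. \<psi> (w * (2 * j * h))))"
    by (subst sum.swap) (simp add: sum_distrib_left)
  also have "\<dots> = (\<Sum>h\<in>(UNIV :: 'a set). if h = 0 then of_nat CARD('a) else 0)"
    unfolding psi_sum
  proof (intro sum.cong refl)
    fix h :: 'a
    have "2 * j * h = 0 \<longleftrightarrow> h = 0" using assms two_neq_0 by simp
    then show "\<psi> (j * h ^ 2) * (if 2 * j * h = 0 then of_nat CARD('a) else 0) = (if h = 0 then of_nat CARD('a) else 0)"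
      by simp
  qed
  also have "\<dots> = of_nat CARD('a)" by simp
  finally show ?thesis .
qed

lemma norm_gauss:
  assumes "j \<noteq> 0"
  shows "norm (gauss j) = sqrt (real CARD('a))"
proof -
  have "complex_of_real (norm (gauss j) ^ 2) = of_real (real CARD('a))"
    using gauss_mult_minus[OF assms] unfolding complex_norm_square by (simp add: gauss_minus)
  then have "norm (gauss j) ^ 2 = real CARD('a)" by (simp only: of_real_eq_iff)
  from real_sqrt_unique[OF this norm_ge_zero] show ?thesis by simp
qed

lemma gauss_square_mult:
  assumes "s \<noteq> 0"
  shows "gauss (j * s ^ 2) = gauss j"
  unfolding gauss_def
  by (rule sum.reindex_bij_witness[of _ "\<lambda>z. z / s" "\<lambda>z. s * z"])
    (use assms in \<open>auto simp: power_mult_distrib mult.assoc\<close>)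

text \<open>One more than the quadratic character of \<open>y\<close>.\<close>

definition sqrt_count :: "'a \<Rightarrow> nat" where "sqrt_count y = card {z. z ^ 2 = y}"

lemma sqrt_count_eq:
  fixes z :: 'a
  assumes "z ^ 2 = y"
  shows "{z. z ^ 2 = y} = {z, - z}"
  unfolding assms[symmetric] by (auto simp: power2_eq_iff)

lemma sqrt_count_le: "sqrt_count y \<le> 2"
proof (cases "\<exists>z. z ^ 2 = y")
  case True
  then obtain z where "z ^ 2 = y" by blast
  then show ?thesis unfolding sqrt_count_def sqrt_count_eq[OF \<open>z ^ 2 = y\<close>]
    by (simp add: card_insert_if)
qed (simp add: sqrt_count_def)

lemma sum_sqrt_count: "(\<Sum>y\<in>UNIV. of_nat (sqrt_count y) * (h y :: 'b::comm_semiring_1)) = (\<Sum>z\<in>UNIV. h (z ^ 2))"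
proof -
  have "(\<Sum>z\<in>UNIV. h (z ^ 2)) = (\<Sum>y\<in>UNIV. \<Sum>z\<in>{z\<in>UNIV. z ^ 2 = y}. h (z ^ 2))"
    by (rule sum.group[symmetric]) auto
  also have "\<dots> = (\<Sum>y\<in>UNIV. of_nat (sqrt_count y) * h y)"
    by (intro sum.cong refl) (simp add: sqrt_count_def)
  finally show ?thesis by simp
qed

text \<open>At most one of \<open>y\<close> and \<open>c y\<close> is a nonzero square, so the sum is at most 2 everywhere; it is
  2 on average.\<close>

lemma sqrt_count_nonsquare:
  assumes c: "\<nexists>z. z ^ 2 = c"
  shows "sqrt_count y + sqrt_count (c * y) = 2"
proof -
  have c0: "c \<noteq> 0" using c by (metis zero_power2)
  have le: "sqrt_count y + sqrt_count (c * y) \<le> 2" for y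
  proof (cases "y = 0")
    case True
    then show ?thesis by (simp add: sqrt_count_def)
  next
    case False
    have "sqrt_count y = 0 \<or> sqrt_count (c * y) = 0"
    proof (rule ccontr)
      assume "\<not> ?thesis"
      then have "{z. z ^ 2 = y} \<noteq> {}" "{z. z ^ 2 = c * y} \<noteq> {}" by (auto simp: sqrt_count_def)
      then obtain u v where uv: "u ^ 2 = y" "v ^ 2 = c * y" by blast
      then have "(v / u) ^ 2 = c" using False by (simp add: power_divide)
      with c show False by blast
    qed
    then show ?thesis using sqrt_count_le[of y] sqrt_count_le[of "c * y"] by linarith
  qed
  have total: "(\<Sum>y\<in>UNIV. sqrt_count y) = CARD('a)"
    using sum_sqrt_count[of "\<lambda>_. 1 :: nat"] by simp
  have "(\<Sum>y\<in>UNIV. sqrt_count (c * y)) = (\<Sum>y\<in>UNIV. sqrt_count y)"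
    by (rule sum.reindex_bij_witness[of _ "\<lambda>y. y / c" "\<lambda>y. c * y"]) (use c0 in auto)
  then have sum_eq: "(\<Sum>y\<in>UNIV. sqrt_count y + sqrt_count (c * y)) = (\<Sum>y\<in>(UNIV::'a set). 2)"
    by (simp add: sum.distrib total)
  show ?thesis
  proof (rule ccontr)
    assume "sqrt_count y + sqrt_count (c * y) \<noteq> 2"
    then have "sqrt_count y + sqrt_count (c * y) < 2" using le[of y] by linarith
    then have "(\<Sum>y\<in>UNIV. sqrt_count y + sqrt_count (c * y)) < (\<Sum>y\<in>(UNIV::'a set). 2)"
      using le by (intro sum_strict_mono_ex1) auto
    then show False using sum_eq by linarith
  qed
qed

lemma gauss_sqrt_count: "gauss j = (\<Sum>y\<in>UNIV. of_nat (sqrt_count y) * \<psi> (y * j))"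
  unfolding gauss_def sum_sqrt_count by (simp add: mult.commute)

text \<open>Written through \<open>sqrt_count\<close>, the two Gauss sums have weights that add up
  to 2 at every point, and a constant weight gives a vanishing complete sum.\<close>

lemma gauss_nonsquare_mult:
  assumes c: "\<nexists>z. z ^ 2 = c" and j: "j \<noteq> 0"
  shows "gauss (c * j) = - gauss j"
proof -
  have c0: "c \<noteq> 0" using c by (metis zero_power2)
  have "gauss j = (\<Sum>y\<in>UNIV. of_nat (sqrt_count (c * y)) * \<psi> (y * (c * j)))"
    unfolding gauss_sqrt_count
    by (rule sum.reindex_bij_witness[of _ "\<lambda>y. c * y" "\<lambda>y. y / c"]) (use c0 in \<open>auto simp: ac_simps\<close>)
  then have "gauss (c * j) + gauss j = (\<Sum>y\<in>UNIV. of_nat (sqrt_count y + sqrt_count (c * y)) * \<psi> (y * (c * j)))"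
    unfolding gauss_sqrt_count[of "c * j"] by (simp add: sum.distrib distrib_right)
  also have "\<dots> = 2 * (\<Sum>y\<in>UNIV. \<psi> (y * (c * j)))"
    unfolding sqrt_count_nonsquare[OF c] by (simp add: sum_distrib_left)
  also have "\<dots> = 0" using c0 j by (simp add: psi_sum)
  finally show ?thesis by (simp add: add_eq_0_iff)
qed

text \<open>Here \<sigma> is the quadratic character of \<open>c\<close>. Later steps rely on its
  square alone, which spares them a case distinction.\<close>

lemma gauss_scale:
  assumes "c \<noteq> 0"
  obtains \<sigma> :: complex where "\<sigma> ^ 2 = 1" "\<And>j. j \<noteq> 0 \<Longrightarrow> gauss (c * j) = \<sigma> * gauss j"
proof (cases "\<exists>z. z ^ 2 = c")
  case True
  then obtain z where "z ^ 2 = c" by blast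
  then have "gauss (c * j) = 1 * gauss j" for j
    using gauss_square_mult[of z j] assms by (auto simp: mult.commute)
  then show ?thesis using that[of 1] by simp
next
  case False
  then have "gauss (c * j) = - 1 * gauss j" if "j \<noteq> 0" for j
    using gauss_nonsquare_mult that by simp
  then show ?thesis using that[of "-1"] by simp
qed

text \<open>This lets even powers of Gauss sums leave a sum over \<open>j\<close> as
  constants.\<close>

lemma gauss_square_const:
  assumes "j \<noteq> 0"
  shows "gauss j ^ 2 = gauss 1 ^ 2"
proof -
  obtain \<sigma> where "\<sigma> ^ 2 = 1" "\<And>i. i \<noteq> 0 \<Longrightarrow> gauss (j * i) = \<sigma> * gauss i"
    using gauss_scale[OF assms] by blast
  then show ?thesis by (metis mult.right_neutral mult_1 power_mult_distrib zero_neq_one)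
qed

text \<open>Up to a constant, \<open>gauss j\<close> is the quadratic character of \<open>j\<close>,
  so this is a Salie sum. If a b is a nonsquare, it vanishes by symmetry. Otherwise, or if b = 0,
  unfolding the Gauss sum makes the exponent linear in j, and the sum over j singles out the at most
  two roots of a quadratic equation.\<close>

lemma salie_bound:
  assumes a: "a \<noteq> 0"
  shows "norm (\<Sum>j\<in>UNIV - {0}. gauss j * \<psi> (a * j + b / j)) \<le> 2 * real CARD('a)"
proof (cases "b = 0")
  case True
  have "(\<Sum>j\<in>UNIV - {0}. gauss j * \<psi> (a * j + b / j)) = (\<Sum>j\<in>UNIV - {0}. \<Sum>z\<in>UNIV. \<psi> (j * (z ^ 2 + a)))"
    unfolding gauss_def sum_distrib_right psi_add[symmetric] by (simp add: True algebra_simps)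
  also have "\<dots> = (\<Sum>z\<in>UNIV. (if z ^ 2 + a = 0 then of_nat CARD('a) else 0) - 1)"
    by (subst sum.swap) (simp add: psi_sum_nonzero)
  also have "\<dots> = (\<Sum>z\<in>UNIV. if z ^ 2 = - a then of_nat CARD('a) else 0) - of_nat CARD('a)"
    by (simp add: sum_subtractf flip: eq_neg_iff_add_eq_0)
  also have "(\<Sum>z\<in>UNIV. if z ^ 2 = - a then complex_of_nat CARD('a) else 0) = of_real (real (sqrt_count (- a)) * real CARD('a))"
    by (simp add: sqrt_count_def sum.If_cases Int_def)
  finally have "(\<Sum>j\<in>UNIV - {0}. gauss j * \<psi> (a * j + b / j)) = of_real ((real (sqrt_count (- a)) - 1) * real CARD('a))"
    by (simp add: algebra_simps)
  then have "norm (\<Sum>j\<in>UNIV - {0}. gauss j * \<psi> (a * j + b / j)) = \<bar>real (sqrt_count (- a)) - 1\<bar> * real CARD('a)"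
    by (simp only: norm_of_real abs_mult abs_of_nat)
  moreover have "\<bar>real (sqrt_count (- a)) - 1\<bar> \<le> 2" using sqrt_count_le[of "-a"] by linarith
  ultimately show ?thesis by (simp add: mult_right_mono)
next
  case b: False
  show ?thesis
  proof (cases "\<exists>y. y ^ 2 = a * b")
    case False
    define T where "T = (\<Sum>j\<in>UNIV - {0}. gauss j * \<psi> (a * j + b / j))"
    \<comment> \<open>The substitution j -> b / (a j) exchanges a j and b / j. It flips the sign of
      the Gauss sum, since b / (a j) is a b j up to a square.\<close>
    have "T = (\<Sum>j\<in>UNIV - {0}. gauss (b / (a * j)) * \<psi> (a * j + b / j))"
      unfolding T_def
      by (rule sum.reindex_bij_witness[of _ "\<lambda>j. b / (a * j)" "\<lambda>j. b / (a * j)"])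
        (use a b in \<open>auto simp: add.commute\<close>)
    also have "\<dots> = (\<Sum>j\<in>UNIV - {0}. - (gauss j * \<psi> (a * j + b / j)))"
    proof (intro sum.cong refl)
      fix j :: 'a assume j: "j \<in> UNIV - {0}"
      have "b / (a * j) = (a * b * j) * (1 / (a * j)) ^ 2"
        using a j by (simp add: power2_eq_square)
      then have "gauss (b / (a * j)) = gauss (a * b * j)"
        using gauss_square_mult[of "1 / (a * j)" "a * b * j"] a j by simp
      also have "\<dots> = - gauss j" using gauss_nonsquare_mult[OF False] j by simp
      finally show "gauss (b / (a * j)) * \<psi> (a * j + b / j) = - (gauss j * \<psi> (a * j + b / j))" by simp
    qed
    also have "\<dots> = - T" by (simp add: T_def sum_negf)
    finally have "T = 0" by simp
    then show ?thesis by (simp add: T_def)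
  next
    case True
    then obtain y where y: "y ^ 2 = a * b" by blast
    then have y0: "y \<noteq> 0" using a b by auto
    have "- a \<noteq> 0" using a by simp
    \<comment> \<open>Passing to \<open>gauss (- a * j)\<close> costs the sign \<sigma>. After a
      shift by y / (a j) its square contains the term - y^2 / (a j) = - b / j, which cancels b /
      j.\<close>
    then obtain \<sigma> where \<sigma>: "\<sigma> ^ 2 = 1" "\<And>j. j \<noteq> 0 \<Longrightarrow> gauss (- a * j) = \<sigma> * gauss j"
      using gauss_scale by blast
    have "(\<Sum>j\<in>UNIV - {0}. gauss j * \<psi> (a * j + b / j)) =
        (\<Sum>j\<in>UNIV - {0}. \<Sum>r\<in>UNIV. \<sigma> * (\<psi> (2 * r * y) * \<psi> (j * (a * (1 - r ^ 2)))))"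
    proof (intro sum.cong refl)
      fix j :: 'a assume j: "j \<in> UNIV - {0}"
      have square: "b / j + (- a * j) * (r - y / (a * j)) ^ 2 = 2 * r * y - a * j * r ^ 2" for r
      proof -
        have "(- a * j) * (r - y / (a * j)) ^ 2 = 2 * r * y - a * j * r ^ 2 - y ^ 2 / (a * j)"
          using a j by (simp add: power2_eq_square field_simps)
        moreover have "y ^ 2 / (a * j) = b / j" using a by (simp add: y)
        ultimately show ?thesis by simp
      qed
      have "gauss (- a * j) = (\<Sum>r\<in>UNIV. \<psi> ((- a * j) * (r - y / (a * j)) ^ 2))"
        using gauss_shift[of "- a * j" "- y / (a * j)"] by simp
      then have "\<psi> (b / j) * gauss (- a * j) = (\<Sum>r\<in>UNIV. \<psi> (2 * r * y - a * j * r ^ 2))"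
        by (simp only: sum_distrib_left psi_add[symmetric] square)
      moreover have "gauss j = \<sigma> * gauss (- a * j)" using \<sigma> j by (simp add: power2_eq_square flip: mult.assoc)
      ultimately have "gauss j * \<psi> (a * j + b / j) = \<sigma> * \<psi> (a * j) * (\<Sum>r\<in>UNIV. \<psi> (2 * r * y - a * j * r ^ 2))"
        by (simp add: psi_add mult_ac)
      also have "\<dots> = (\<Sum>r\<in>UNIV. \<sigma> * (\<psi> (a * j) * \<psi> (2 * r * y - a * j * r ^ 2)))"
        by (simp add: sum_distrib_left mult.assoc)
      also have "\<dots> = (\<Sum>r\<in>UNIV. \<sigma> * (\<psi> (2 * r * y) * \<psi> (j * (a * (1 - r ^ 2)))))"
        unfolding psi_add[symmetric] by (simp add: algebra_simps)
      finally show "gauss j * \<psi> (a * j + b / j) = \<dots>" .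
    qed
    also have "\<dots> = \<sigma> * (\<Sum>r\<in>UNIV. \<psi> (2 * r * y) * (\<Sum>j\<in>UNIV - {0}. \<psi> (j * (a * (1 - r ^ 2)))))"
      by (subst sum.swap) (simp add: sum_distrib_left)
    \<comment> \<open>Only r = 1 and r = -1 make the coefficient of j vanish; the missing term j = 0
      subtracts a complete sum over r, which is 0.\<close>
    also have "(\<Sum>r\<in>UNIV. \<psi> (2 * r * y) * (\<Sum>j\<in>UNIV - {0}. \<psi> (j * (a * (1 - r ^ 2))))) =
        (\<Sum>r\<in>UNIV. if r \<in> {1, -1} then \<psi> (2 * r * y) * of_nat CARD('a) else 0) - (\<Sum>r\<in>UNIV. \<psi> (r * (2 * y)))"
      unfolding psi_sum_nonzero sum_subtractf[symmetric]
    proof (intro sum.cong refl)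
      fix r :: 'a
      have "a * (1 - r ^ 2) = 0 \<longleftrightarrow> r \<in> {1, -1}" using a by (auto simp: power2_eq_1_iff)
      then show "\<psi> (2 * r * y) * ((if a * (1 - r ^ 2) = 0 then of_nat CARD('a) else 0) - 1) =
          (if r \<in> {1, -1} then \<psi> (2 * r * y) * of_nat CARD('a) else 0) - \<psi> (r * (2 * y))"
        by (simp add: algebra_simps)
    qed
    also have "(\<Sum>r\<in>UNIV. \<psi> (r * (2 * y))) = 0" using y0 two_neq_0 by (simp add: psi_sum)
    also have "(\<Sum>r\<in>UNIV. if r \<in> {1, -1} then \<psi> (2 * r * y) * of_nat CARD('a) else 0) =
        (\<Sum>r\<in>{1, -1}. \<psi> (2 * r * y) * of_nat CARD('a))"
      by (intro sum.mono_neutral_cong_right) auto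
    finally have eq: "(\<Sum>j\<in>UNIV - {0}. gauss j * \<psi> (a * j + b / j)) =
        \<sigma> * (\<Sum>r\<in>{1, -1}. \<psi> (2 * r * y) * of_nat CARD('a))" by simp
    have "norm \<sigma> ^ 2 = 1 ^ 2" unfolding norm_power[symmetric] \<sigma>(1) by simp
    then have \<sigma>1: "norm \<sigma> = 1" by (rule power2_eq_imp_eq) auto
    have "norm (\<Sum>r\<in>{1, -1}. \<psi> (2 * r * y) * of_nat CARD('a)) \<le> real (card {1, -1 :: 'a}) * real CARD('a)"
      by (intro sum_norm_bound) (simp add: norm_mult)
    also have "\<dots> \<le> 2 * real CARD('a)"
      by (intro mult_right_mono) (auto simp: card_insert_if)
    finally show ?thesis unfolding eq norm_mult \<sigma>1 by simp
  qed
qed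

text \<open>For even \<open>d\<close> the power of the Gauss sum is constant and a Kloosterman sum
  remains, or just -1 if \<open>b = 0\<close>. For odd \<open>d\<close> one Gauss factor is left
  over, which gives a Salie sum.\<close>

lemma gauss_power_sum_bound:
  assumes a: "a \<noteq> 0"
  shows "norm (\<Sum>j\<in>UNIV - {0}. gauss j ^ d * \<psi> (a * j + b / j)) \<le> 2 * sqrt (real CARD('a)) ^ (d + 1)"
proof (cases "even d")
  case True
  then obtain m where d: "d = 2 * m" by (auto elim: evenE)
  have K: "norm (\<Sum>j\<in>UNIV - {0}. \<psi> (a * j + b / j)) \<le> 2 * sqrt (real CARD('a))"
  proof (cases "b = 0")
    case True
    have "1 \<le> sqrt (real CARD('a))" using real_sqrt_ge_1_iff[of "real CARD('a)"] by (simp add: Suc_leI)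
    then have "1 \<le> 2 * sqrt (real CARD('a))" by linarith
    then show ?thesis using psi_sum_nonzero[of a] a True by (simp add: mult.commute)
  next
    case False
    then show ?thesis using kloosterman_bound[OF a] by simp
  qed
  have "(\<Sum>j\<in>UNIV - {0}. gauss j ^ d * \<psi> (a * j + b / j)) = (\<Sum>j\<in>UNIV - {0}. gauss 1 ^ d * \<psi> (a * j + b / j))"
  proof (intro sum.cong refl)
    fix j :: 'a assume "j \<in> UNIV - {0}"
    then show "gauss j ^ d * \<psi> (a * j + b / j) = gauss 1 ^ d * \<psi> (a * j + b / j)"
      unfolding d power_mult using gauss_square_const[of j] by simp
  qed
  also have "\<dots> = gauss 1 ^ d * (\<Sum>j\<in>UNIV - {0}. \<psi> (a * j + b / j))"
    by (simp add: sum_distrib_left)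
  also have "norm \<dots> \<le> sqrt (real CARD('a)) ^ d * (2 * sqrt (real CARD('a)))"
    unfolding norm_mult norm_power norm_gauss[OF one_neq_zero]
    by (intro mult_left_mono K) simp
  finally show ?thesis by (simp add: mult_ac)
next
  case False
  then obtain m where d: "d = 2 * m + 1" by (auto elim: oddE)
  have "(\<Sum>j\<in>UNIV - {0}. gauss j ^ d * \<psi> (a * j + b / j)) =
      (\<Sum>j\<in>UNIV - {0}. gauss 1 ^ (2 * m) * (gauss j * \<psi> (a * j + b / j)))"
  proof (intro sum.cong refl)
    fix j :: 'a assume "j \<in> UNIV - {0}"
    then show "gauss j ^ d * \<psi> (a * j + b / j) = gauss 1 ^ (2 * m) * (gauss j * \<psi> (a * j + b / j))"
      unfolding d power_add power_mult using gauss_square_const[of j] by simp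
  qed
  also have "\<dots> = gauss 1 ^ (2 * m) * (\<Sum>j\<in>UNIV - {0}. gauss j * \<psi> (a * j + b / j))"
    by (simp add: sum_distrib_left)
  also have "norm \<dots> \<le> sqrt (real CARD('a)) ^ (2 * m) * (2 * real CARD('a))"
    unfolding norm_mult norm_power norm_gauss[OF one_neq_zero]
    by (intro mult_left_mono salie_bound a) simp
  also have "\<dots> = 2 * sqrt (real CARD('a)) ^ (d + 1)" by (simp add: d power_add)
  finally show ?thesis .
qed


subsection \<open>Pseudorandomness of distances\<close>

lemma sum_psi_fdot:
  "(\<Sum>\<xi>\<in>UNIV. \<psi> (fdot \<xi> v)) = (if v = 0 then of_nat CARD('a) ^ CARD('d) else 0)"
  for v :: "'a ^ 'd"
proof -
  have "(\<Sum>\<xi>\<in>UNIV. \<psi> (fdot \<xi> v)) = (\<Sum>\<xi>\<in>UNIV. \<Prod>i\<in>UNIV. \<psi> (\<xi> $ i * v $ i))"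
    by (simp add: fdot_def psi_of_sum)
  also have "\<dots> = (\<Prod>i\<in>UNIV. \<Sum>z\<in>UNIV. \<psi> (z * v $ i))"
    by (rule sum_vec_prod)
  also have "\<dots> = (\<Prod>i\<in>UNIV. if v $ i = 0 then of_nat CARD('a) else 0)"
    by (simp add: psi_sum)
  also have "\<dots> = (if v = 0 then of_nat CARD('a) ^ CARD('d) else 0)"
  proof (cases "v = 0")
    case False
    then obtain i where "v $ i \<noteq> 0" by (auto simp: vec_eq_iff)
    then have "(\<Prod>i\<in>UNIV. if v $ i = 0 then of_nat CARD('a) else 0 :: complex) = 0"
      by (intro prod_zero) auto
    then show ?thesis using False by simp
  qed simp
  finally show ?thesis .
qed

text \<open>A Gaussian is its own Fourier transform up to constants, with j turned into -1/(4j), as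
  seen by completing the square in each coordinate. Applied to |x - y|^2 it separates x from
  y.\<close>

lemma psi_fnorm2_expansion:
  fixes v :: "'a ^ 'd"
  assumes j: "j \<noteq> 0"
  shows "of_nat CARD('a) ^ CARD('d) * \<psi> (j * fnorm2 v) =
    gauss j ^ CARD('d) * (\<Sum>\<xi>\<in>UNIV. \<psi> (fdot \<xi> v) * \<psi> (- fnorm2 \<xi> / (4 * j)))"
proof -
  have four: "(4::'a) \<noteq> 0" 
  proof -
    have "(4::'a) = 2 * 2" by simp
    then show ?thesis using two_neq_0 by (metis mult_eq_0_iff)
  qed
  define c where "c = - (1 / (4 * j))"
  \<comment> \<open>Since c is -j times a square, \<open>gauss c\<close> equals
    \<open>gauss (- j)\<close>, and its product with \<open>gauss j\<close> is q.\<close>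
  have "c = (- j) * (1 / (2 * j)) ^ 2" using j by (simp add: c_def power2_eq_square)
  then have gc: "gauss j * gauss c = of_nat CARD('a)"
    using gauss_square_mult[of "1 / (2 * j)" "- j"] gauss_mult_minus[OF j] j two_neq_0 by simp
  have "(\<Sum>\<xi>\<in>UNIV. \<psi> (fdot \<xi> v) * \<psi> (- fnorm2 \<xi> / (4 * j))) =
      (\<Sum>\<xi>\<in>UNIV. \<Prod>i\<in>UNIV. \<psi> (\<xi> $ i * v $ i + c * (\<xi> $ i) ^ 2))"
  proof (intro sum.cong refl)
    fix \<xi> :: "'a ^ 'd"
    have "(\<Sum>i\<in>UNIV. \<xi> $ i * v $ i + c * (\<xi> $ i) ^ 2) = fdot \<xi> v + c * fnorm2 \<xi>"
      by (simp add: fdot_def fnorm2_def sum.distrib sum_distrib_left power2_eq_square)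
    also have "c * fnorm2 \<xi> = - fnorm2 \<xi> / (4 * j)" by (simp add: c_def)
    finally show "\<psi> (fdot \<xi> v) * \<psi> (- fnorm2 \<xi> / (4 * j)) = (\<Prod>i\<in>UNIV. \<psi> (\<xi> $ i * v $ i + c * (\<xi> $ i) ^ 2))"
      by (simp only: psi_add[symmetric] psi_of_sum[OF finite, symmetric])
  qed
  also have "\<dots> = (\<Prod>i\<in>UNIV. \<Sum>z\<in>UNIV. \<psi> (z * v $ i + c * z ^ 2))"
    by (rule sum_vec_prod)
  also have "\<dots> = (\<Prod>i\<in>UNIV. \<psi> (j * (v $ i) ^ 2) * gauss c)"
  proof (intro prod.cong refl)
    fix i :: 'd
    have "z * v $ i + c * z ^ 2 = j * (v $ i) ^ 2 + c * (z + - (2 * j * v $ i)) ^ 2" for z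
    proof -
      have "c * (z + - (2 * j * v $ i)) ^ 2 = c * z ^ 2 - (4 * j * c) * (z * v $ i) + (4 * j * c) * (j * (v $ i) ^ 2)"
        by (simp add: power2_eq_square algebra_simps)
      also have "4 * j * c = - 1" using j four by (simp add: c_def)
      finally show ?thesis by simp
    qed
    then have "(\<Sum>z\<in>UNIV. \<psi> (z * v $ i + c * z ^ 2)) =
        \<psi> (j * (v $ i) ^ 2) * (\<Sum>z\<in>UNIV. \<psi> (c * (z + - (2 * j * v $ i)) ^ 2))"
      by (simp only: psi_add sum_distrib_left)
    then show "(\<Sum>z\<in>UNIV. \<psi> (z * v $ i + c * z ^ 2)) = \<psi> (j * (v $ i) ^ 2) * gauss c"
      by (simp only: gauss_shift)
  qed
  also have "\<dots> = \<psi> (j * fnorm2 v) * gauss c ^ CARD('d)"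
    by (simp add: prod.distrib fnorm2_def fdot_def sum_distrib_left power2_eq_square psi_of_sum)
  finally have "gauss j ^ CARD('d) * (\<Sum>\<xi>\<in>UNIV. \<psi> (fdot \<xi> v) * \<psi> (- fnorm2 \<xi> / (4 * j))) =
      (gauss j * gauss c) ^ CARD('d) * \<psi> (j * fnorm2 v)"
    by (simp add: power_mult_distrib mult_ac)
  then show ?thesis unfolding gc by simp
qed

definition fourier :: "('a ^ 'd) set \<Rightarrow> 'a ^ 'd \<Rightarrow> complex" where
  "fourier B \<xi> = (\<Sum>x\<in>B. \<psi> (fdot \<xi> x))"

lemma fdot_diff: "fdot \<xi> (x - y) = fdot \<xi> x + - fdot \<xi> y"
  by (simp add: fdot_def algebra_simps sum_subtractf)

lemma plancherel:
  fixes B :: "('a ^ 'd) set"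
  shows "(\<Sum>\<xi>\<in>UNIV. norm (fourier B \<xi>) ^ 2) = real CARD('a) ^ CARD('d) * real (card B)"
proof -
  have "complex_of_real (\<Sum>\<xi>\<in>UNIV. norm (fourier B \<xi>) ^ 2) =
      (\<Sum>\<xi>\<in>UNIV. \<Sum>x\<in>B. \<Sum>y\<in>B. \<psi> (fdot \<xi> (x - y)))"
    unfolding of_real_sum complex_norm_square fdot_diff psi_add psi_minus
    by (simp add: fourier_def sum_product)
  also have "\<dots> = (\<Sum>x\<in>B. \<Sum>\<xi>\<in>UNIV. \<Sum>y\<in>B. \<psi> (fdot \<xi> (x - y)))"
    by (rule sum.swap)
  also have "\<dots> = (\<Sum>x\<in>B. \<Sum>y\<in>B. \<Sum>\<xi>\<in>UNIV. \<psi> (fdot \<xi> (x - y)))"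
    by (intro sum.cong refl sum.swap)
  also have "\<dots> = (\<Sum>x\<in>B. of_nat CARD('a) ^ CARD('d))"
    unfolding sum_psi_fdot by (intro sum.cong refl) simp
  also have "\<dots> = complex_of_real (real CARD('a) ^ CARD('d) * real (card B))" by simp
  finally show ?thesis by (simp only: of_real_eq_iff)
qed

text \<open>Cauchy-Schwarz reduces this to Plancherel for each of the sets.\<close>

lemma sum_fourier_product_bound:
  fixes B C :: "('a ^ 'd) set"
  shows "(\<Sum>\<xi>\<in>UNIV. norm (fourier B \<xi>) * norm (fourier C \<xi>)) \<le>
    real CARD('a) ^ CARD('d) * sqrt (real (card B) * real (card C))"
proof -
  have "(\<Sum>\<xi>\<in>UNIV. norm (fourier B \<xi>) * norm (fourier C \<xi>)) \<le>
      L2_set (\<lambda>\<xi>. norm (fourier B \<xi>)) UNIV * L2_set (\<lambda>\<xi>. norm (fourier C \<xi>)) UNIV"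
    using L2_set_mult_ineq[of "\<lambda>\<xi>. norm (fourier B \<xi>)" "\<lambda>\<xi>. norm (fourier C \<xi>)" UNIV] by simp
  also have "\<dots> = sqrt ((real CARD('a) ^ CARD('d)) ^ 2 * (real (card B) * real (card C)))"
    unfolding L2_set_def plancherel real_sqrt_mult[symmetric] by (simp add: power2_eq_square mult_ac)
  also have "\<dots> = real CARD('a) ^ CARD('d) * sqrt (real (card B) * real (card C))"
    by (simp add: real_sqrt_mult)
  finally show ?thesis .
qed

text \<open>Summing the character of j (|x - y|^2 - r) over j detects the distance r. The term j = 0
  is the expected |B||C|. For the others the Fourier expansion separates x from y and leaves at
  \<xi> the coefficient \<open>W \<xi>\<close>, bounded uniformly in \<xi>.\<close>

lemma distance_mixing:
  fixes B C :: "('a ^ 'd) set"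
  assumes r: "r \<noteq> 0"
  shows "\<bar>real CARD('a) * real (card {(x, y) \<in> B \<times> C. fnorm2 (x - y) = r}) - real (card B) * real (card C)\<bar>
    \<le> 2 * sqrt (real CARD('a)) ^ (CARD('d) + 1) * sqrt (real (card B) * real (card C))"
proof -
  define Q :: complex where "Q = of_nat CARD('a) ^ CARD('d)"
  define N where "N = card {(x, y) \<in> B \<times> C. fnorm2 (x - y) = r}"
  define W where "W \<xi> = (\<Sum>j\<in>UNIV - {0}. gauss j ^ CARD('d) * \<psi> ((- r) * j + (- fnorm2 \<xi> / 4) / j))" for \<xi> :: "'a ^ 'd"
  define h where "h = (\<lambda>j (x :: 'a ^ 'd, y). \<psi> (j * (fnorm2 (x - y) - r)))"
  have "of_nat CARD('a) * of_nat N = (\<Sum>t\<in>B \<times> C. if fnorm2 (fst t - snd t) = r then of_nat CARD('a) else 0 :: complex)"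
    by (simp add: sum.If_cases N_def case_prod_unfold Int_def mem_Times_iff conj_assoc)
  also have "\<dots> = (\<Sum>t\<in>B \<times> C. \<Sum>j\<in>UNIV. h j t)"
    by (intro sum.cong refl) (simp add: h_def case_prod_unfold psi_sum)
  also have "\<dots> = (\<Sum>j\<in>UNIV. \<Sum>t\<in>B \<times> C. h j t)"
    by (rule sum.swap)
  also have "\<dots> = (\<Sum>t\<in>B \<times> C. h 0 t) + (\<Sum>j\<in>UNIV - {0}. \<Sum>t\<in>B \<times> C. h j t)"
    by (simp add: sum.remove)
  also have "(\<Sum>t\<in>B \<times> C. h 0 t) = of_nat (card B) * of_nat (card C)"
    by (simp add: h_def case_prod_unfold)
  finally have "of_nat CARD('a) * of_nat N - of_nat (card B) * of_nat (card C) =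
      (\<Sum>j\<in>UNIV - {0}. \<Sum>t\<in>B \<times> C. h j t)" by simp
  \<comment> \<open>\<open>Q\<close> clears the denominator of the Fourier expansion; the same
    factor from Plancherel cancels it at the end.\<close>
  then have "Q * (of_nat CARD('a) * of_nat N - of_nat (card B) * of_nat (card C)) =
      (\<Sum>j\<in>UNIV - {0}. \<Sum>t\<in>B \<times> C. Q * h j t)"
    by (simp add: sum_distrib_left)
  also have "\<dots> = (\<Sum>j\<in>UNIV - {0}. \<Sum>t\<in>B \<times> C. \<Sum>\<xi>\<in>UNIV.
      gauss j ^ CARD('d) * \<psi> ((- r) * j + (- fnorm2 \<xi> / 4) / j) * (\<psi> (fdot \<xi> (fst t)) * cnj (\<psi> (fdot \<xi> (snd t)))))"
  proof (intro sum.cong refl)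
    fix j :: 'a and t :: "('a ^ 'd) \<times> ('a ^ 'd)"
    assume "j \<in> UNIV - {0}"
    then have j: "j \<noteq> 0" by simp
    have "Q * h j t = \<psi> (- r * j) * (Q * \<psi> (j * fnorm2 (fst t - snd t)))"
      unfolding h_def case_prod_unfold by (simp add: algebra_simps flip: psi_add)
    also have "\<dots> = (\<Sum>\<xi>\<in>UNIV. \<psi> (- r * j) * (gauss j ^ CARD('d) *
        (\<psi> (fdot \<xi> (fst t - snd t)) * \<psi> (- fnorm2 \<xi> / (4 * j)))))"
      unfolding Q_def psi_fnorm2_expansion[OF j] by (simp add: sum_distrib_left)
    also have "\<dots> = (\<Sum>\<xi>\<in>UNIV. gauss j ^ CARD('d) * \<psi> ((- r) * j + (- fnorm2 \<xi> / 4) / j) *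
        (\<psi> (fdot \<xi> (fst t)) * cnj (\<psi> (fdot \<xi> (snd t)))))"
      unfolding fdot_diff psi_add psi_minus divide_divide_eq_left by (simp add: mult_ac)
    finally show "Q * h j t = \<dots>" .
  qed
  also have "\<dots> = (\<Sum>j\<in>UNIV - {0}. \<Sum>\<xi>\<in>UNIV. \<Sum>t\<in>B \<times> C.
      gauss j ^ CARD('d) * \<psi> ((- r) * j + (- fnorm2 \<xi> / 4) / j) * (\<psi> (fdot \<xi> (fst t)) * cnj (\<psi> (fdot \<xi> (snd t)))))"
    by (intro sum.cong refl sum.swap)
  also have "\<dots> = (\<Sum>\<xi>\<in>UNIV. \<Sum>j\<in>UNIV - {0}. \<Sum>t\<in>B \<times> C.
      gauss j ^ CARD('d) * \<psi> ((- r) * j + (- fnorm2 \<xi> / 4) / j) * (\<psi> (fdot \<xi> (fst t)) * cnj (\<psi> (fdot \<xi> (snd t)))))"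
    by (rule sum.swap)
  also have "\<dots> = (\<Sum>\<xi>\<in>UNIV. W \<xi> * (fourier B \<xi> * cnj (fourier C \<xi>)))"
  proof (intro sum.cong refl)
    fix \<xi> :: "'a ^ 'd"
    have "fourier B \<xi> * cnj (fourier C \<xi>) = (\<Sum>t\<in>B \<times> C. \<psi> (fdot \<xi> (fst t)) * cnj (\<psi> (fdot \<xi> (snd t))))"
      by (simp add: fourier_def sum_product sum.cartesian_product case_prod_unfold)
    then show "(\<Sum>j\<in>UNIV - {0}. \<Sum>t\<in>B \<times> C. gauss j ^ CARD('d) * \<psi> ((- r) * j + (- fnorm2 \<xi> / 4) / j) *
        (\<psi> (fdot \<xi> (fst t)) * cnj (\<psi> (fdot \<xi> (snd t))))) = W \<xi> * (fourier B \<xi> * cnj (fourier C \<xi>))"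
      by (simp only: W_def sum_product)
  qed
  finally have main: "Q * (of_nat CARD('a) * of_nat N - of_nat (card B) * of_nat (card C)) =
      (\<Sum>\<xi>\<in>UNIV. W \<xi> * (fourier B \<xi> * cnj (fourier C \<xi>)))" .
  define w where "w = 2 * sqrt (real CARD('a)) ^ (CARD('d) + 1)"
  \<comment> \<open>The nonzero r enters as the coefficient of j. The coefficient of 1/j may vanish,
    for instance at \<xi> = 0.\<close>
  have W: "norm (W \<xi>) \<le> w" for \<xi>
    unfolding W_def w_def using r by (intro gauss_power_sum_bound) simp
  have w0: "w \<ge> 0" by (simp add: w_def)
  have cast: "of_nat CARD('a) * of_nat N - of_nat (card B) * of_nat (card C) =
      complex_of_real (real CARD('a) * real N - real (card B) * real (card C))" by simp
  have "real CARD('a) ^ CARD('d) * \<bar>real CARD('a) * real N - real (card B) * real (card C)\<bar> =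
      norm (Q * (of_nat CARD('a) * of_nat N - of_nat (card B) * of_nat (card C)))"
    unfolding cast norm_mult norm_of_real by (simp add: Q_def norm_power)
  also have "\<dots> \<le> (\<Sum>\<xi>\<in>UNIV. w * (norm (fourier B \<xi>) * norm (fourier C \<xi>)))"
    unfolding main
    by (intro sum_norm_le) (simp add: norm_mult W mult_right_mono)
  also have "\<dots> \<le> w * (real CARD('a) ^ CARD('d) * sqrt (real (card B) * real (card C)))"
    unfolding sum_distrib_left[symmetric] by (intro mult_left_mono sum_fourier_product_bound w0)
  finally have "real CARD('a) ^ CARD('d) * \<bar>real CARD('a) * real N - real (card B) * real (card C)\<bar> \<le>
      real CARD('a) ^ CARD('d) * (w * sqrt (real (card B) * real (card C)))" by (simp add: mult_ac)
  then have "\<bar>real CARD('a) * real N - real (card B) * real (card C)\<bar> \<le> w * sqrt (real (card B) * real (card C))"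
    by (rule mult_left_le_imp_le) simp
  then show ?thesis by (simp add: N_def w_def)
qed

end

subsection \<open>Embedding distance graphs\<close>

lemma fnorm2_diff_commute: "fnorm2 (x - y) = fnorm2 (y - x)"
proof -
  have "(x $ j - y $ j) * (x $ j - y $ j) = (y $ j - x $ j) * (y $ j - x $ j)" for j
    by (simp add: algebra_simps)
  then show ?thesis by (simp add: fnorm2_def fdot_def)
qed

text \<open>If all points of \<open>B\<close> have too few neighbours in \<open>C\<close>, the edge
  count falls short of |B||C|/q by a proportion \<epsilon>, which mixing permits only for small
  |B||C|. It is applied with a candidate set as \<open>C\<close> and the bad choices as
  \<open>B\<close>.\<close>

lemma few_low_degree_points:
  fixes B C :: "('a::{field,finite} ^ 'd) set"
  assumes odd: "odd CARD('a)" and r: "r \<noteq> 0" and \<epsilon>: "\<epsilon> > 0"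
    and low: "\<And>x. x \<in> B \<Longrightarrow>
      real CARD('a) * real (card {y \<in> C. fnorm2 (x - y) = r}) \<le> (1 - \<epsilon>) * real (card C)"
  shows "\<epsilon> ^ 2 * real (card B) * real (card C) \<le> 4 * real CARD('a) ^ (CARD('d) + 1)"
proof -
  obtain \<psi> :: "'a \<Rightarrow> complex" where "kloosterman_character \<psi>"
    using ex_kloosterman_character[OF odd] by blast
  then interpret kloosterman_character \<psi> .
  define N where "N = card {(x, y) \<in> B \<times> C. fnorm2 (x - y) = r}"
  define Z where "Z = real (card B) * real (card C)"
  define s where "s = sqrt (real CARD('a)) ^ (CARD('d) + 1)"
  have Z0: "Z \<ge> 0" by (simp add: Z_def)
  have "{(x, y) \<in> B \<times> C. fnorm2 (x - y) = r} = Sigma B (\<lambda>x. {y \<in> C. fnorm2 (x - y) = r})" by auto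
  then have "N = (\<Sum>x\<in>B. card {y \<in> C. fnorm2 (x - y) = r})"
    unfolding N_def by (simp add: card_SigmaI)
  then have "real CARD('a) * real N = (\<Sum>x\<in>B. real CARD('a) * real (card {y \<in> C. fnorm2 (x - y) = r}))"
    by (simp add: sum_distrib_left)
  also have "\<dots> \<le> (\<Sum>x\<in>B. (1 - \<epsilon>) * real (card C))" by (intro sum_mono low)
  also have "\<dots> = Z - \<epsilon> * Z" by (simp add: Z_def algebra_simps)
  finally have "\<epsilon> * Z \<le> \<bar>real CARD('a) * real N - Z\<bar>" by linarith
  also have "\<dots> \<le> 2 * s * sqrt Z"
    unfolding N_def Z_def s_def by (rule distance_mixing[OF r])
  finally have "(\<epsilon> * Z) ^ 2 \<le> (2 * s * sqrt Z) ^ 2"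
    using Z0 \<epsilon> by (intro power_mono) auto
  then have "(\<epsilon> ^ 2 * Z) * Z \<le> (4 * s ^ 2) * Z"
    unfolding power_mult_distrib real_sqrt_pow2[OF Z0] by (simp add: power2_eq_square mult_ac)
  then have "\<epsilon> ^ 2 * Z \<le> 4 * s ^ 2"
    using Z0 by (cases "Z = 0") (auto dest: mult_right_le_imp_le)
  moreover have "s ^ 2 = real CARD('a) ^ (CARD('d) + 1)"
    unfolding s_def by (simp only: power_mult[symmetric] mult.commute[of _ 2]) (simp only: power_mult real_sqrt_pow2 of_nat_0_le_iff)
  ultimately show ?thesis by (simp add: Z_def mult.assoc)
qed

text \<open>\<open>P\<close> stands for q^((d-1)/2), given by an identity between integral powers so
  that no real exponents occur. A vertex with k placed neighbours always keeps at least |A| / (2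
  q^k) candidates.\<close>

lemma greedy_embedding:
  fixes A :: "('a::{field,finite} ^ 'd) set" and V :: "'v set" and P :: real
  assumes odd: "odd CARD('a)" and graph: "distance_graph V E lam"
    and deg: "\<And>v. v \<in> V \<Longrightarrow> vdegree V E v \<le> t"
    and P1: "P \<ge> 1" and P: "P ^ 2 * real CARD('a) ^ 2 = real CARD('a) ^ (CARD('d) + 1)"
    and size: "12 * real (card V) ^ 2 * P * real CARD('a) ^ t \<le> real (card A)"
  shows "contains_isometric_copy A V E lam"
proof -
  define n where "n = card V"
  define q where "q = real CARD('a)"
  \<comment> \<open>With at most n losses by the factor 1 - \<epsilon>, Bernoulli's inequality
    retains at least one half; this turns the 12 into a 6 below.\<close>
  define \<epsilon> where "\<epsilon> = 1 / (2 * real n)"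
  define \<rho> where "\<rho> = (1 - \<epsilon>) / q"
  define nb where "nb W v = {w \<in> W. {v, w} \<in> E}" for W v
  define cand where "cand W \<phi> v = {x \<in> A. \<forall>w\<in>nb W v. fnorm2 (x - \<phi> w) = lam {v, w}}" for W v and \<phi> :: "'v \<Rightarrow> 'a ^ 'd"
  \<comment> \<open>The induction invariant; its last clause is what allows the next vertex to be
    placed.\<close>
  define good where "good W \<phi> \<longleftrightarrow> inj_on \<phi> W \<and> \<phi> ` W \<subseteq> A \<and>
      (\<forall>u\<in>W. \<forall>w\<in>W. {u, w} \<in> E \<longrightarrow> fnorm2 (\<phi> u - \<phi> w) = lam {u, w}) \<and>
      (\<forall>v\<in>V - W. real (card A) * \<rho> ^ card (nb W v) \<le> real (card (cand W \<phi> v)))" for W and \<phi> :: "'v \<Rightarrow> 'a ^ 'd"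
  have finV: "finite V" and lam: "\<And>e. e \<in> E \<Longrightarrow> lam e \<noteq> 0"
    and E: "E \<subseteq> {{u, w} | u w. u \<in> V \<and> w \<in> V \<and> u \<noteq> w}"
    using graph by (auto simp: distance_graph_def)
  have noloop: "{u, u} \<notin> E" for u
    using E by (auto simp: doubleton_eq_iff)
  have q1: "q \<ge> 1" by (simp add: q_def Suc_leI)
  have nbdeg: "card (nb W v) \<le> t" "card (nb W v) \<le> n" if "W \<subseteq> V" "v \<in> V" for W v
  proof -
    have "card (nb W v) \<le> vdegree V E v"
      unfolding nb_def vdegree_def using that finV by (intro card_mono) auto
    then show "card (nb W v) \<le> t" using deg[OF that(2)] by simp
    show "card (nb W v) \<le> n"
      unfolding nb_def n_def using that finV by (intro card_mono) auto
  qed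
  have large: "6 * real n ^ 2 * P * q ^ (t - card (nb W v)) \<le> real (card A) * \<rho> ^ card (nb W v)"
    if "W \<subseteq> V" "v \<in> V" for W v
  proof -
    define k where "k = card (nb W v)"
    have k: "k \<le> t" "k \<le> n" using nbdeg[OF that] by (simp_all add: k_def)
    have n1: "real n \<ge> 1" using that(2) finV by (auto simp: n_def Suc_le_eq card_gt_0_iff)
    have "1 / 2 \<le> 1 + real k * (- \<epsilon>)"
      using k n1 by (simp add: \<epsilon>_def field_simps)
    also have "\<dots> \<le> (1 + - \<epsilon>) ^ k"
      using n1 by (intro Bernoulli_inequality) (simp add: \<epsilon>_def field_simps)
    finally have half: "1 / 2 \<le> (1 - \<epsilon>) ^ k" by simp
    have "6 * real n ^ 2 * P * q ^ (t - k) = (12 * real n ^ 2 * P * q ^ t) * (1 / 2) / q ^ k"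
      using k q1 by (simp add: power_diff)
    also have "\<dots> \<le> real (card A) * (1 - \<epsilon>) ^ k / q ^ k"
      using half size q1 P1 unfolding n_def q_def by (intro divide_right_mono mult_mono) auto
    also have "\<dots> = real (card A) * \<rho> ^ k" by (simp add: \<rho>_def power_divide)
    finally show ?thesis by (simp add: k_def)
  qed
  have "\<exists>\<phi>. good W \<phi>" if "W \<subseteq> V" for W
    using finite_subset[OF that finV] that
  proof (induction W rule: finite_induct)
    case empty
    then show ?case by (auto simp: good_def nb_def cand_def)
  next
    case (insert u W)
    then obtain \<phi> where "good W \<phi>" by auto
    then have inj: "inj_on \<phi> W" and \<phi>A: "\<phi> ` W \<subseteq> A"
      and edges: "\<And>v w. v \<in> W \<Longrightarrow> w \<in> W \<Longrightarrow> {v, w} \<in> E \<Longrightarrow> fnorm2 (\<phi> v - \<phi> w) = lam {v, w}"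
      and cands: "\<And>v. v \<in> V - W \<Longrightarrow> real (card A) * \<rho> ^ card (nb W v) \<le> real (card (cand W \<phi> v))"
      by (auto simp: good_def)
    have u: "u \<in> V" "u \<notin> W" and WV: "W \<subseteq> V" using insert by auto
    have finW: "finite W" by (rule insert.hyps)
    have n1: "n \<ge> 1" using u finV by (auto simp: n_def Suc_le_eq card_gt_0_iff)
    have candlarge: "6 * real n ^ 2 * P * q ^ (t - card (nb W v)) \<le> real (card (cand W \<phi> v))" if "v \<in> V - W" for v
      using large[OF WV DiffD1[OF that]] cands[OF that] by (rule order_trans)
    define U where "U = {v \<in> V - insert u W. {u, v} \<in> E}"
    \<comment> \<open>Placing u at a point of \<open>bad v\<close> would shrink the candidates of
      its neighbour v to a proportion of at most \<rho>.\<close>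
    define bad where "bad v = {x \<in> cand W \<phi> u. q * real (card {y \<in> cand W \<phi> v. fnorm2 (x - y) = lam {u, v}}) \<le>
        (1 - \<epsilon>) * real (card (cand W \<phi> v))}" for v
    have finU: "finite U" using finV by (simp add: U_def)
    have Pq: "P * q \<ge> 1" using mult_mono[OF P1 q1] P1 q1 by simp
    \<comment> \<open>The unplaced neighbour w takes up one of at most t edges at v, so at most t -
      1 neighbours are placed and a factor q is left over.\<close>
    have adj: "6 * real n ^ 2 * (P * q) \<le> real (card (cand W \<phi> v))"
      if v: "v \<in> V - W" "w \<in> V - W" "{v, w} \<in> E" for v w
    proof -
      have "insert w (nb W v) \<subseteq> {w \<in> V. {v, w} \<in> E}" using v WV by (auto simp: nb_def)
      then have "card (insert w (nb W v)) \<le> vdegree V E v"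
        unfolding vdegree_def using finV by (intro card_mono) auto
      also have "\<dots> \<le> t" using deg v by simp
      finally have "card (insert w (nb W v)) \<le> t" .
      then have "card (nb W v) + 1 \<le> t" using v finW by (simp add: nb_def)
      then have "q ^ 1 \<le> q ^ (t - card (nb W v))" using q1 by (intro power_increasing) auto
      then have "6 * real n ^ 2 * P * q ^ 1 \<le> 6 * real n ^ 2 * P * q ^ (t - card (nb W v))"
        using P1 by (intro mult_left_mono) auto
      then show ?thesis using candlarge[OF v(1)] by (simp add: mult.assoc)
    qed
    \<comment> \<open>Since \<epsilon>^2 n^2 = 1/4 and v has at least 6 n^2 P q candidates, the
      estimate is (8/3) P q, rounded up to 3 P q.\<close>
    have cardbad: "real (card (bad v)) \<le> 3 * (P * q)" if "v \<in> U" for v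
    proof -
      have v: "v \<in> V - W" "{u, v} \<in> E" "{v, u} \<in> E" using that by (auto simp: U_def insert_commute)
      have "\<epsilon> ^ 2 * real (card (bad v)) * real (card (cand W \<phi> v)) \<le> 4 * real CARD('a) ^ (CARD('d) + 1)"
        using n1 by (intro few_low_degree_points[OF odd lam[OF v(2)]]) (auto simp: bad_def q_def \<epsilon>_def)
      also have "\<dots> = 4 * (P * q) ^ 2" by (simp only: P[symmetric] q_def power_mult_distrib)
      finally have 1: "\<epsilon> ^ 2 * real (card (bad v)) * real (card (cand W \<phi> v)) \<le> 4 * (P * q) ^ 2" .
      have "\<epsilon> ^ 2 * real (card (bad v)) * (6 * real n ^ 2 * (P * q)) \<le>
          \<epsilon> ^ 2 * real (card (bad v)) * real (card (cand W \<phi> v))"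
        using adj[OF v(1) _ v(3)] u by (intro mult_left_mono) auto
      also note 1
      finally have 2: "\<epsilon> ^ 2 * real (card (bad v)) * (6 * real n ^ 2 * (P * q)) \<le> 4 * (P * q) ^ 2" .
      have "\<epsilon> ^ 2 * real n ^ 2 = 1 / 4" using n1 by (simp add: \<epsilon>_def power_divide power_mult_distrib)
      then have 3: "\<epsilon> ^ 2 * real (card (bad v)) * (6 * real n ^ 2 * (P * q)) = 1 / 4 * (6 * (real (card (bad v)) * (P * q)))"
        by (metis (no_types, opaque_lifting) mult.assoc mult.left_commute)
      have "(3 / 2 * real (card (bad v))) * (P * q) \<le> (4 * (P * q)) * (P * q)"
        using 2 unfolding 3 unfolding power2_eq_square by (simp add: mult_ac)
      then have "3 / 2 * real (card (bad v)) \<le> 4 * (P * q)"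
        by (rule mult_right_le_imp_le) (use Pq in linarith)
      then show ?thesis using Pq by linarith
    qed
    have cardUW: "card U + card W + 1 \<le> n"
    proof -
      have "card (insert u (U \<union> W)) \<le> n"
        unfolding n_def using u WV by (intro card_mono finV) (auto simp: U_def)
      moreover have "card (insert u (U \<union> W)) = card U + card W + 1"
        using finU finW u by (subst card_insert_disjoint) (auto simp: U_def intro!: card_Un_disjoint)
      ultimately show ?thesis by simp
    qed
    \<comment> \<open>If u has no unplaced neighbour, no factor q need be left over, but then only
      the fewer than n occupied points are excluded. Otherwise at most 3 P q points are charged to
      each vertex of \<open>U\<close> and \<open>W\<close>, in total fewer than 3 n P q and hence
      fewer than 6 n^2 P q.\<close>
    have "card (\<phi> ` W \<union> (\<Union>v\<in>U. bad v)) < card (cand W \<phi> u)"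
    proof (cases "U = {}")
      case True
      have "real n * 1 \<le> real n * (6 * real n)" using n1 by (intro mult_left_mono) auto
      also have "\<dots> = 6 * real n ^ 2 * (1 * 1)" by (simp add: power2_eq_square)
      also have "\<dots> \<le> 6 * real n ^ 2 * (P * q ^ (t - card (nb W u)))"
        using P1 q1 by (intro mult_left_mono mult_mono one_le_power) auto
      also have "\<dots> \<le> real (card (cand W \<phi> u))" using candlarge[of u] u by (simp add: mult.assoc)
      finally have "n \<le> card (cand W \<phi> u)" by simp
      moreover have "card (\<phi> ` W) \<le> card W" by (rule card_image_le[OF finW])
      ultimately show ?thesis using True cardUW by simp
    next
      case False
      then obtain v where v: "v \<in> V - W" "{u, v} \<in> E" by (auto simp: U_def)
      have "card (\<phi> ` W \<union> (\<Union>v\<in>U. bad v)) \<le> card (\<phi> ` W) + card (\<Union>v\<in>U. bad v)" by (rule card_Un_le)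
      also have "\<dots> \<le> card W + (\<Sum>v\<in>U. card (bad v))"
        by (intro add_mono card_image_le finW card_UN_le finU)
      finally have "real (card (\<phi> ` W \<union> (\<Union>v\<in>U. bad v))) \<le> real (card W) + (\<Sum>v\<in>U. real (card (bad v)))"
        by (simp flip: of_nat_sum of_nat_add)
      also have "\<dots> \<le> real (card W) * (3 * (P * q)) + (\<Sum>v\<in>U. 3 * (P * q))"
      proof (intro add_mono sum_mono cardbad)
        have "real (card W) * 1 \<le> real (card W) * (3 * (P * q))" using Pq by (intro mult_left_mono) auto
        then show "real (card W) \<le> real (card W) * (3 * (P * q))" by simp
      qed
      also have "\<dots> = (real (card W) + real (card U)) * (3 * (P * q))" by (simp add: algebra_simps)
      also have "\<dots> < real n * (3 * (P * q))"
        using cardUW Pq by (intro mult_strict_right_mono) auto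
      also have "\<dots> \<le> (2 * real n ^ 2) * (3 * (P * q))"
      proof (intro mult_right_mono)
        have "real n * 1 \<le> real n * (2 * real n)" using n1 by (intro mult_left_mono) auto
        then show "real n \<le> 2 * real n ^ 2" by (simp add: power2_eq_square mult_ac)
      qed (use Pq in auto)
      also have "\<dots> \<le> real (card (cand W \<phi> u))" using adj[OF _ v] u by simp
      finally show ?thesis by simp
    qed
    then have "\<not> cand W \<phi> u \<subseteq> \<phi> ` W \<union> (\<Union>v\<in>U. bad v)"
      by (meson card_mono finite leD)
    then obtain x where x: "x \<in> cand W \<phi> u" "x \<notin> \<phi> ` W" "\<And>v. v \<in> U \<Longrightarrow> x \<notin> bad v" by auto
    define \<phi>' where "\<phi>' = \<phi>(u := x)"
    have \<phi>'W: "\<phi>' w = \<phi> w" if "w \<in> W" for w using that u by (auto simp: \<phi>'_def)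
    have \<phi>'u: "\<phi>' u = x" by (simp add: \<phi>'_def)
    have xu: "fnorm2 (x - \<phi> w) = lam {u, w}" if "w \<in> W" "{u, w} \<in> E" for w
    proof -
      have "w \<in> nb W u" using that by (simp add: nb_def)
      then show ?thesis using x(1) by (simp add: cand_def)
    qed
    have "good (insert u W) \<phi>'"
      unfolding good_def
    proof (intro conjI ballI impI)
      show "inj_on \<phi>' (insert u W)"
      proof -
        have "inj_on \<phi>' W" using inj inj_on_cong[of W \<phi>' \<phi>] \<phi>'W by blast
        moreover have "\<phi>' ` W = \<phi> ` W" using \<phi>'W by (rule image_cong[OF refl])
        ultimately show ?thesis using x(2) u by (simp add: \<phi>'u)
      qed
      show "\<phi>' ` insert u W \<subseteq> A"
      proof -
        have "\<phi>' ` W = \<phi> ` W" using \<phi>'W by (rule image_cong[OF refl])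
        then show ?thesis using \<phi>A x(1) by (simp add: \<phi>'u cand_def)
      qed
      fix v w assume vw: "v \<in> insert u W" "w \<in> insert u W" "{v, w} \<in> E"
      show "fnorm2 (\<phi>' v - \<phi>' w) = lam {v, w}"
      proof (cases "v = u"; cases "w = u")
        assume "v = u" "w = u" then show ?thesis using vw noloop by simp
      next
        assume "v = u" "w \<noteq> u" then show ?thesis using vw xu[of w] by (simp add: \<phi>'W \<phi>'u)
      next
        assume *: "v \<noteq> u" "w = u"
        then have "{u, v} \<in> E" "v \<in> W" using vw by (auto simp: insert_commute)
        then show ?thesis using xu[of v] fnorm2_diff_commute[of x "\<phi> v"] *
          by (simp add: \<phi>'W \<phi>'u insert_commute)
      next
        assume "v \<noteq> u" "w \<noteq> u" then show ?thesis using vw edges[of v w] by (simp add: \<phi>'W)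
      qed
    next
      fix v assume v: "v \<in> V - insert u W"
      have vW: "v \<in> V - W" using v by auto
      show "real (card A) * \<rho> ^ card (nb (insert u W) v) \<le> real (card (cand (insert u W) \<phi>' v))"
      proof (cases "{u, v} \<in> E")
        case False
        then have nb: "nb (insert u W) v = nb W v" by (auto simp: nb_def insert_commute)
        have "cand (insert u W) \<phi>' v = cand W \<phi> v"
          unfolding cand_def nb using \<phi>'W by (auto simp: nb_def)
        then show ?thesis using cands[OF vW] nb by simp
      next
        case True
        then have nb: "nb (insert u W) v = insert u (nb W v)" by (auto simp: nb_def insert_commute)
        have cnb: "card (insert u (nb W v)) = Suc (card (nb W v))"
          using u finW by (simp add: nb_def)
        have cand: "cand (insert u W) \<phi>' v = {y \<in> cand W \<phi> v. fnorm2 (x - y) = lam {u, v}}"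
          unfolding cand_def nb using \<phi>'W \<phi>'u fnorm2_diff_commute[of x] by (auto simp: nb_def insert_commute)
        have "v \<in> U" using v True by (simp add: U_def)
        then have "(1 - \<epsilon>) * real (card (cand W \<phi> v)) \<le> q * real (card (cand (insert u W) \<phi>' v))"
          using x(1) x(3)[of v] unfolding cand bad_def by auto
        then have "\<rho> * real (card (cand W \<phi> v)) \<le> real (card (cand (insert u W) \<phi>' v))"
          using q1 by (simp add: \<rho>_def field_simps)
        moreover have "0 \<le> \<rho>" using n1 q1 by (simp add: \<rho>_def \<epsilon>_def)
        then have "\<rho> * (real (card A) * \<rho> ^ card (nb W v)) \<le> \<rho> * real (card (cand W \<phi> v))"
          by (intro mult_left_mono cands vW)
        ultimately show ?thesis unfolding nb cnb by (simp add: mult_ac)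
      qed
    qed
    then show ?case by blast
  qed
  then obtain \<phi> where "good V \<phi>" by blast
  then show ?thesis
    unfolding contains_isometric_copy_def isometric_copy_def good_def
    by (intro exI[of _ "\<phi> ` V"] conjI exI[of _ \<phi>]) (auto simp: bij_betw_def)
qed

theorem theorem1p2:
  fixes A :: "('a::{field,finite} ^ 'd) set"
    and n t :: nat
  assumes q_odd: "odd CARD('a)"
    and A_large: "real (card A) \<ge>
        12 * real n ^ 2 * real CARD('a) powr ((real CARD('d) - 1) / 2 + real t)"
  shows "\<forall>(V :: 'v set) E (lam :: 'v set \<Rightarrow> 'a).
           distance_graph V E lam \<and> card V = n \<and> (\<forall>v\<in>V. vdegree V E v \<le> t)
           \<longrightarrow> contains_isometric_copy A V E lam"
proof (intro allI impI, elim conjE)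
  fix V :: "'v set" and E and lam :: "'v set \<Rightarrow> 'a"
  assume graph: "distance_graph V E lam" and n: "card V = n" and deg: "\<forall>v\<in>V. vdegree V E v \<le> t"
  define P where "P = real CARD('a) powr ((real CARD('d) - 1) / 2)"
  have q1: "real CARD('a) \<ge> 1" and d1: "real CARD('d) \<ge> 1" by (simp_all add: Suc_leI)
  have q0: "real CARD('a) > 0" by simp
  show "contains_isometric_copy A V E lam"
  proof (rule greedy_embedding[OF q_odd graph])
    show "vdegree V E v \<le> t" if "v \<in> V" for v using deg that by simp
    show "P \<ge> 1" unfolding P_def using q1 d1 by (intro ge_one_powr_ge_zero) auto
    show "P ^ 2 * real CARD('a) ^ 2 = real CARD('a) ^ (CARD('d) + 1)"
    proof -
      have "P ^ 2 = real CARD('a) powr (real CARD('d) - 1)"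
        unfolding P_def power2_eq_square powr_add[symmetric] by simp
      moreover have "real CARD('a) ^ 2 = real CARD('a) powr 2" using q0 by (simp add: powr_numeral)
      ultimately have "P ^ 2 * real CARD('a) ^ 2 = real CARD('a) powr (real CARD('d) - 1 + 2)"
        by (simp only: powr_add)
      also have "real CARD('d) - 1 + 2 = real (CARD('d) + 1)" by simp
      also have "real CARD('a) powr real (CARD('d) + 1) = real CARD('a) ^ (CARD('d) + 1)"
        by (rule powr_realpow[OF q0])
      finally show ?thesis .
    qed
    show "12 * real (card V) ^ 2 * P * real CARD('a) ^ t \<le> real (card A)"
      using A_large unfolding powr_add powr_realpow[OF q0] P_def[symmetric] n by (simp only: mult.assoc)
  qed
qed

end
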